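(* For any $\alpha>0$, there exist $\tau_\alpha>0$ and $c>0$ (depending only on $\alpha$) such that for all $\tau\ge\tau_\alpha$, all $d\ge1$, all $\eta\in\mathbb{R}^d$ with $|\eta_1|\ge\cdots\ge|\eta_d|>0$, all $\sigma>0$ and all integers $s\in[d]$, $$\inf_{\hat T}\ \sup_{\theta\in\Theta_s}\ \sup_{\mathcal P_\xi\in\mathcal H_{\alpha,\tau}^{\otimes}}\mathbb{E}_{\theta,\mathcal P_\xi}\big(\hat T-L(\theta)\big)^2\ \ge\ c\,\sigma^2\,\Phi_{\rm o}(s;\eta).$$ Furthermore, if (i) $s\ge3$ and $s^2+s\le d+1$, and (ii) there is some constant $\bar C$ such that $$\sum_{j=s^2}^d\frac{\lambda_{\mathcal H}^4}{\eta_j^4}\exp\left(-2\left|\frac{\lambda_{\mathcal H}}{\eta_j}\right|^{\alpha}\right)\le\bar C,$$ where $\lambda_{\mathcal H}\ge0$ is the unique solution of $\sum_{j=s^2}^d\exp(-|\lambda/\eta_j|^\alpha)=s$ in $\lambda\ge0$, then there exists a constant $c'>0$ depending only on $(\alpha,\tau,\bar C)$ such that $$\inf_{\hat T}\ \sup_{\theta\in\Theta_s}\ \sup_{\mathcal P_\xi\in\mathcal H_{\alpha,\tau}^{\otimes}}\mathbb{E}_{\theta,\mathcal P_\xi}\big(\hat T-L(\theta)\big)^2\ \ge\ c'\,\sigma^2s^2\lambda_{\mathcal H}^2.$$ Here the infima are over all estimators $\hat T$.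
   Context: Model: $[d]=\{1,\dots,d\}$; $\eta\in\mathbb{R}^d$ is known with $|\eta_1|\ge\cdots\ge|\eta_d|>0$; one observes $y_j=\theta_j+\sigma\xi_j$, $j\in[d]$, with $\theta\in\mathbb{R}^d$ unknown, $\sigma>0$, and $\xi_1,\dots,\xi_d$ independent with joint law $\mathcal P_\xi$; $\mathbb{E}_{\theta,\mathcal P_\xi}$ is the corresponding expectation. $L(\theta)=\sum_{j=1}^d\eta_j\theta_j$, $\Theta_s=\{\theta\in\mathbb{R}^d:\#\{j:\theta_j\ne0\}\le s\}$. An estimator is any measurable real-valued function of $(y_1,\dots,y_d)$. Noise class (not necessarily symmetric): for $\alpha,\tau>0$, $\mathcal H_{\alpha,\tau}$ is the class of distributions on $\mathbb{R}$ of random variables $W$ with $\mathbb{E}(W)=0$, $\mathbb{E}(W^2)=1$ and $\mathbb{P}(|W|\ge t)\le2\exp\{-(t/\tau)^\alpha\}$ for all $t\ge0$; $\mathcal H_{\alpha,\tau}^{\otimes}=\{\otimes_{j=1}^dP_j:P_j\in\mathcal H_{\alpha,\tau}\}$. Rate $\Phi_{\rm o}$: $\beta\in\mathbb{R}$ is the unique solution of $\sum_{j=1}^d|\eta_j|e^{-\beta/|\eta_j|^\alpha}\big/\sqrt{\sum_{j=1}^d\eta_j^2e^{-\beta/|\eta_j|^\alpha}}=s/2$ (left side strictly decreasing from $+\infty$ to $0$); $\lambda_o=(\max(\beta,0))^{1/\alpha}$, $\nu=\sqrt{\sum_{j=1}^d\eta_j^2\exp(-(\lambda_o/|\eta_j|)^\alpha)}$,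 $\Phi_{\rm o}(s;\eta)=(\lambda_os+\nu)^2$. The function $\lambda\mapsto\sum_{j=s^2}^d\exp(-|\lambda/\eta_j|^\alpha)$ is continuous and strictly decreasing on $[0,\infty)$ from $d-s^2+1$ to $0$, so $\lambda_{\mathcal H}$ exists and is unique whenever $s^2+s\le d+1$. *)

theory Defs
  imports "HOL-Probability.Probability"
begin

text \<open>
  Vectors in \<open>\<real>^d\<close> are functions on the index set \<open>{1..d}\<close>; parameters, noise and observations
  live in \<open>{1..d} \<rightarrow>\<^sub>E UNIV\<close>, the space of the product measures \<open>Pi\<^sub>M {1..d} _\<close>. The weights
  \<open>\<eta>\<close> only matter on \<open>{1..d}\<close>.
\<close>

definition ordered_weights :: "nat \<Rightarrow> (nat \<Rightarrow> real) \<Rightarrow> bool" where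
  "ordered_weights d \<eta> \<longleftrightarrow>
     (\<forall>i\<in>{1..d}. \<forall>j\<in>{1..d}. i \<le> j \<longrightarrow> \<bar>\<eta> j\<bar> \<le> \<bar>\<eta> i\<bar>) \<and> \<bar>\<eta> d\<bar> > 0"

definition lin_functional :: "nat \<Rightarrow> (nat \<Rightarrow> real) \<Rightarrow> (nat \<Rightarrow> real) \<Rightarrow> real" where
  "lin_functional d \<eta> \<theta> = (\<Sum>j=1..d. \<eta> j * \<theta> j)"

definition sparse_vectors :: "nat \<Rightarrow> nat \<Rightarrow> (nat \<Rightarrow> real) set" where
  "sparse_vectors d s = {\<theta> \<in> {1..d} \<rightarrow>\<^sub>E UNIV. card {j\<in>{1..d}. \<theta> j \<noteq> 0} \<le> s}"

definition estimators :: "nat \<Rightarrow> ((nat \<Rightarrow> real) \<Rightarrow> real) set" where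
  "estimators d = borel_measurable (\<Pi>\<^sub>M j\<in>{1..d}. (borel :: real measure))"

text \<open>Laws on \<open>\<real>\<close>; the power with base 0 is 0 here, as it should be for \<open>\<alpha> > 0\<close>.\<close>

definition noise_laws :: "real \<Rightarrow> real \<Rightarrow> real measure set" where
  "noise_laws \<alpha> \<tau> = {P. prob_space P \<and> sets P = sets borel \<and>
     has_bochner_integral P (\<lambda>w. w) 0 \<and>
     has_bochner_integral P (\<lambda>w. w\<^sup>2) 1 \<and>
     (\<forall>t\<ge>0. measure P {w. \<bar>w\<bar> \<ge> t} \<le> 2 * exp (- ((t / \<tau>) powr \<alpha>)))}"

definition noise_product_laws :: "nat \<Rightarrow> real \<Rightarrow> real \<Rightarrow> (nat \<Rightarrow> real) measure set" where
  "noise_product_laws d \<alpha> \<tau> = {Pi\<^sub>M {1..d} P |P. \<forall>j\<in>{1..d}. P j \<in> noise_laws \<alpha> \<tau>}"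

text \<open>The squared error may fail to be integrable, so risks are valued in \<open>[0,\<infinity>]\<close>.\<close>

definition sq_risk ::
  "nat \<Rightarrow> (nat \<Rightarrow> real) \<Rightarrow> real \<Rightarrow> ((nat \<Rightarrow> real) \<Rightarrow> real) \<Rightarrow> (nat \<Rightarrow> real) \<Rightarrow> (nat \<Rightarrow> real) measure \<Rightarrow> ennreal"
  where
  "sq_risk d \<eta> \<sigma> T \<theta> Q =
     (\<integral>\<^sup>+ \<xi>. ennreal ((T (\<lambda>j\<in>{1..d}. \<theta> j + \<sigma> * \<xi> j) - lin_functional d \<eta> \<theta>)\<^sup>2) \<partial>Q)"

definition minimax_risk :: "nat \<Rightarrow> nat \<Rightarrow> (nat \<Rightarrow> real) \<Rightarrow> real \<Rightarrow> real \<Rightarrow> real \<Rightarrow> ennreal" where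
  "minimax_risk d s \<eta> \<sigma> \<alpha> \<tau> =
     (INF T \<in> estimators d. SUP \<theta> \<in> sparse_vectors d s. SUP Q \<in> noise_product_laws d \<alpha> \<tau>.
        sq_risk d \<eta> \<sigma> T \<theta> Q)"

text \<open>
  For \<open>d \<ge> 1\<close>, \<open>s \<ge> 1\<close> and nonzero weights, the ratio below is continuous and strictly decreasing in
  \<open>\<beta>\<close>, from \<open>+\<infinity>\<close> to 0, so the description is well defined; \<open>\<beta>\<close> may be negative.
\<close>

definition beta_o :: "real \<Rightarrow> nat \<Rightarrow> nat \<Rightarrow> (nat \<Rightarrow> real) \<Rightarrow> real" where
  "beta_o \<alpha> d s \<eta> = (THE \<beta>.
     (\<Sum>j=1..d. \<bar>\<eta> j\<bar> * exp (- \<beta> / \<bar>\<eta> j\<bar> powr \<alpha>)) /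
       sqrt (\<Sum>j=1..d. (\<eta> j)\<^sup>2 * exp (- \<beta> / \<bar>\<eta> j\<bar> powr \<alpha>)) = real s / 2)"

definition lambda_o :: "real \<Rightarrow> nat \<Rightarrow> nat \<Rightarrow> (nat \<Rightarrow> real) \<Rightarrow> real" where
  "lambda_o \<alpha> d s \<eta> = (max (beta_o \<alpha> d s \<eta>) 0) powr (1 / \<alpha>)"

definition nu_o :: "real \<Rightarrow> nat \<Rightarrow> nat \<Rightarrow> (nat \<Rightarrow> real) \<Rightarrow> real" where
  "nu_o \<alpha> d s \<eta> =
     sqrt (\<Sum>j=1..d. (\<eta> j)\<^sup>2 * exp (- ((lambda_o \<alpha> d s \<eta> / \<bar>\<eta> j\<bar>) powr \<alpha>)))"

definition Phi_o :: "real \<Rightarrow> nat \<Rightarrow> nat \<Rightarrow> (nat \<Rightarrow> real) \<Rightarrow> real" where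
  "Phi_o \<alpha> d s \<eta> = (lambda_o \<alpha> d s \<eta> * real s + nu_o \<alpha> d s \<eta>)\<^sup>2"

text \<open>Well defined for \<open>1 \<le> s\<close>, \<open>s\<^sup>2 + s \<le> d + 1\<close> and nonzero weights.\<close>

definition lambda_H :: "real \<Rightarrow> nat \<Rightarrow> nat \<Rightarrow> (nat \<Rightarrow> real) \<Rightarrow> real" where
  "lambda_H \<alpha> d s \<eta> =
     (THE x. x \<ge> 0 \<and> (\<Sum>j=s\<^sup>2..d. exp (- (\<bar>x / \<eta> j\<bar> powr \<alpha>))) = real s)"

end

theory Submission
  imports Defs
begin

text \<open>
  Sparse signal can be disguised as noise. Let \<open>B\<^sub>j\<close> be independent Bernoulli variables with small success
  probabilities \<open>p\<^sub>j\<close>, put \<open>c\<^sub>j = sgn \<eta>\<^sub>j a\<^sub>j\<close>, and compare the model with \<open>\<theta> = 0\<close> and noise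
  \<open>Z\<^sub>j + c\<^sub>j B\<^sub>j\<close> to the model with \<open>\<theta>\<^sub>j = \<sigma> c\<^sub>j B\<^sub>j\<close> and noise \<open>Z\<^sub>j\<close>. Given \<open>B\<close>, the observations have
  the same form, and only the three-point law of \<open>Z\<close> differs: in the first model it compensates the
  mean and variance of \<open>c\<^sub>j B\<^sub>j\<close>, at a chi-square cost of order \<open>\<Sum> p\<^sub>j\<^sup>2 a\<^sub>j\<^sup>4\<close> (for \<open>a\<^sub>j \<ge> 1\<close>).
  If this cost is bounded, a change of measure given \<open>B\<close> and an average over the \<open>B\<close> with at most \<open>s\<close>
  successes show that the root of the risk is at least of order \<open>\<sigma> \<Sum> |\<eta>\<^sub>j| a\<^sub>j p\<^sub>j\<close>; no concentration of
  \<open>L(\<theta>)\<close> is needed.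

  For the first bound take \<open>a\<^sub>j = max (\<lambda>\<^sub>o / |\<eta>\<^sub>j|) 1\<close> and \<open>p\<^sub>j\<close> proportional to
  \<open>|\<eta>\<^sub>j| exp (- (\<lambda>\<^sub>o / |\<eta>\<^sub>j|)\<^sup>\<alpha>) / \<nu>\<close>. For the second one, if the indices \<open>j \<ge> s\<^sup>2\<close> with
  \<open>|\<eta>\<^sub>j| \<le> \<lambda>\<close> carry at least half of the sum defining \<open>\<lambda> = \<lambda>\<^sub>H\<close>, take there \<open>a\<^sub>j = \<lambda> / |\<eta>\<^sub>j|\<close> and \<open>p\<^sub>j\<close>
  proportional to \<open>exp (- a\<^sub>j\<^sup>\<alpha>)\<close>; otherwise \<open>|\<eta>\<^sub>j| \<ge> \<lambda>\<close> for all \<open>j \<le> s\<^sup>2\<close>, and \<open>a\<^sub>j = 1\<close> with \<open>p\<^sub>j\<close>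
  proportional to \<open>1 / s\<close> on these indices works.
\<close>

section \<open>Product measures of discrete laws\<close>

text \<open>\<open>noise_laws\<close> asks for the Borel sigma-algebra, while
  \<open>measure_pmf\<close> carries the discrete one; the push-forward along the identity only
  replaces the sigma-algebra.\<close>

definition law :: "real pmf \<Rightarrow> real measure" where
  "law p = distr (measure_pmf p) borel (\<lambda>x. x)"

lemma sets_law [simp, measurable_cong]: "sets (law p) = sets borel"
  by (simp add: law_def)

lemma prob_space_law: "prob_space (law p)"
  unfolding law_def by (rule measure_pmf.prob_space_distr) simp

text \<open>Both sides agree on boxes, which determine a product measure. The restriction is there
  because \<open>Pi_pmf\<close> takes the value \<open>dflt\<close> outside \<open>I\<close>,
  whereas points of the space of \<open>Pi\<^sub>M\<close> are \<open>undefined\<close>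
  there.\<close>

lemma PiM_law:
  assumes "finite I"
  shows "Pi\<^sub>M I (\<lambda>i. law (p i)) =
    distr (measure_pmf (Pi_pmf I dflt p)) (Pi\<^sub>M I (\<lambda>i. borel)) (\<lambda>f. restrict f I)"
proof (rule sym)
  interpret product_sigma_finite "\<lambda>i. law (p i)"
    by (intro product_sigma_finite.intro prob_space_imp_sigma_finite prob_space_law)
  show "distr (measure_pmf (Pi_pmf I dflt p)) (Pi\<^sub>M I (\<lambda>i. borel)) (\<lambda>f. restrict f I) = Pi\<^sub>M I (\<lambda>i. law (p i))"
  proof (rule PiM_eqI)
    show "finite I" by fact
    show "sets (distr (measure_pmf (Pi_pmf I dflt p)) (Pi\<^sub>M I (\<lambda>i. borel)) (\<lambda>f. restrict f I)) =
        sets (Pi\<^sub>M I (\<lambda>i. law (p i)))"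
      unfolding sets_distr by (intro sets_PiM_cong) auto
  next
    fix A assume A: "\<And>i. i \<in> I \<Longrightarrow> A i \<in> sets (law (p i))"
    have [measurable]: "(\<lambda>f. restrict f I) \<in> measurable (measure_pmf (Pi_pmf I dflt p)) (Pi\<^sub>M I (\<lambda>i. borel :: real measure))"
      by (rule measurable_restrict) simp
    have "Pi\<^sub>E I A \<in> sets (Pi\<^sub>M I (\<lambda>i. borel :: real measure))"
      using A assms by (intro sets_PiM_I_finite) auto
    hence "emeasure (distr (measure_pmf (Pi_pmf I dflt p)) (Pi\<^sub>M I (\<lambda>i. borel)) (\<lambda>f. restrict f I)) (Pi\<^sub>E I A)
      = emeasure (measure_pmf (Pi_pmf I dflt p)) ((\<lambda>f. restrict f I) -` Pi\<^sub>E I A)"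
      by (subst emeasure_distr) (auto simp: space_PiM)
    also have "(\<lambda>f. restrict f I) -` Pi\<^sub>E I A = Pi I A"
      by (auto simp: PiE_def Pi_def)
    also have "emeasure (measure_pmf (Pi_pmf I dflt p)) (Pi I A) = (\<Prod>i\<in>I. emeasure (p i) (A i))"
      using assms by (simp add: measure_pmf.emeasure_eq_measure measure_Pi_pmf_Pi prod_ennreal)
    also have "\<dots> = (\<Prod>i\<in>I. emeasure (law (p i)) (A i))"
      using A by (intro prod.cong refl) (simp add: law_def emeasure_distr)
    finally show "emeasure (distr (measure_pmf (Pi_pmf I dflt p)) (Pi\<^sub>M I (\<lambda>i. borel)) (\<lambda>f. restrict f I)) (Pi\<^sub>E I A)
      = (\<Prod>i\<in>I. emeasure (law (p i)) (A i))" .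
  qed
qed

text \<open>The map may vary with the coordinate, as the shifts \<open>of_bool (B j) * c j\<close>
  will. Written as a bind with point masses, it commutes with the product.\<close>

lemma Pi_pmf_map_dependent:
  assumes "finite A"
  shows "Pi_pmf A d (\<lambda>x. map_pmf (f x) (g x)) =
    map_pmf (\<lambda>h x. if x \<in> A then f x (h x) else d) (Pi_pmf A d' g)"
  using assms by (simp add: map_pmf_def Pi_pmf_bind[where d' = d'])

text \<open>The integrand sees \<xi> only on \<open>{1..d}\<close>, so the restriction from
  \<open>PiM_law\<close> disappears and the risk becomes an integral over a pmf, free of
  measurability questions.\<close>

lemma sq_risk_law:
  assumes [measurable]: "T \<in> estimators d"
  shows "sq_risk d \<eta> \<sigma> T \<theta> (Pi\<^sub>M {1..d} (\<lambda>j. law (q j))) =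
    (\<integral>\<^sup>+ \<xi>. ennreal ((T (\<lambda>j\<in>{1..d}. \<theta> j + \<sigma> * \<xi> j) - lin_functional d \<eta> \<theta>)\<^sup>2) \<partial>Pi_pmf {1..d} 0 q)"
proof -
  have T [measurable]: "T \<in> borel_measurable (\<Pi>\<^sub>M j\<in>{1..d}. (borel :: real measure))"
    using assms by (simp add: estimators_def)
  have m: "(\<lambda>\<xi>. ennreal ((T (\<lambda>j\<in>{1..d}. \<theta> j + \<sigma> * \<xi> j) - lin_functional d \<eta> \<theta>)\<^sup>2)) 
     \<in> borel_measurable (\<Pi>\<^sub>M j\<in>{1..d}. (borel :: real measure))"
    by measurable
  have [measurable]: "(\<lambda>f. restrict f {1..d}) \<in> measurable (measure_pmf (Pi_pmf {1..d} 0 q)) (Pi\<^sub>M {1..d} (\<lambda>i. borel :: real measure))"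
    by (rule measurable_restrict) simp
  show ?thesis
    unfolding sq_risk_def PiM_law[OF finite_atLeastAtMost, where dflt = 0]
    using m by (subst nn_integral_distr) (auto simp: restrict_def space_PiM PiE_def extensional_def cong: if_cong)
qed

section \<open>Change of measure and the three-point noise\<close>

text \<open>Cauchy-Schwarz, after splitting \<open>pmf Q x * f x\<close> into
  \<open>pmf Q x / sqrt (pmf P x)\<close> and \<open>sqrt (pmf P x) * f x\<close>. The factor is one
  plus the chi-square divergence of \<open>Q\<close> from \<open>P\<close>.\<close>

lemma chi_square_change_of_measure:
  fixes f :: "'a \<Rightarrow> real"
  assumes A: "finite A" "set_pmf P \<subseteq> A" "set_pmf Q \<subseteq> A"
    and pos: "\<And>x. x \<in> A \<Longrightarrow> pmf P x > 0"
  shows "(measure_pmf.expectation Q f)\<^sup>2 \<le>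
    (\<Sum>x\<in>A. (pmf Q x)\<^sup>2 / pmf P x) * measure_pmf.expectation P (\<lambda>x. (f x)\<^sup>2)"
proof -
  have "(measure_pmf.expectation Q f)\<^sup>2 = (\<Sum>x\<in>A. (pmf Q x / sqrt (pmf P x)) * (sqrt (pmf P x) * f x))\<^sup>2"
    using A pos by (subst integral_measure_pmf[of A]) (auto intro!: arg_cong[where f = "\<lambda>x. x\<^sup>2"] sum.cong simp: less_imp_neq[symmetric])
  also have "\<dots> \<le> (\<Sum>x\<in>A. (pmf Q x / sqrt (pmf P x))\<^sup>2) * (\<Sum>x\<in>A. (sqrt (pmf P x) * f x)\<^sup>2)"
    by (rule Cauchy_Schwarz_ineq_sum)
  also have "(\<Sum>x\<in>A. (sqrt (pmf P x) * f x)\<^sup>2) = measure_pmf.expectation P (\<lambda>x. (f x)\<^sup>2)"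
    using A by (subst integral_measure_pmf[of A]) (auto simp: power_mult_distrib)
  finally show ?thesis by (simp add: power_divide)
qed

text \<open>
  The weights are determined by mean \<open>- p c\<close> and second moment \<open>1 - p c\<^sup>2 + 2 p\<^sup>2 c\<^sup>2\<close>, so that
  \<open>contaminated_pmf\<close> has mean 0 and variance 1; \<open>base_pmf 0 0\<close> is the uncontaminated noise.
\<close>

definition base_pmf :: "real \<Rightarrow> real \<Rightarrow> real pmf" where
  "base_pmf p c = (let v = 1 - p * c\<^sup>2 + 2 * p\<^sup>2 * c\<^sup>2 in
     pmf_of_list [(2, v / 8 - p * c / 4), (0, 1 - v / 4), (-2, v / 8 + p * c / 4)])"

definition contaminated_pmf :: "real \<Rightarrow> real \<Rightarrow> real pmf" where
  "contaminated_pmf p c =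
     bernoulli_pmf p \<bind> (\<lambda>b. map_pmf (\<lambda>z. z + of_bool b * c) (base_pmf p c))"

text \<open>The bounds \<open>1/8\<close> keep the outer weights of \<open>base_pmf p c\<close> at
  least \<open>5/64\<close> and the middle one at least \<open>3/4\<close>, so that dividing by
  these weights in the chi-square sum is harmless.\<close>

locale contamination =
  fixes p c :: real
  assumes p: "0 \<le> p" "p \<le> 1/2" and mean_le: "p * \<bar>c\<bar> \<le> 1/8" and var_le: "p * c\<^sup>2 \<le> 1/8"
begin

lemma base_pmf_bounds:
  "5 / 64 \<le> (1 - p * c\<^sup>2 + 2 * p\<^sup>2 * c\<^sup>2) / 8 - p * c / 4"
  "5 / 64 \<le> (1 - p * c\<^sup>2 + 2 * p\<^sup>2 * c\<^sup>2) / 8 + p * c / 4"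
  "3 / 4 \<le> 1 - (1 - p * c\<^sup>2 + 2 * p\<^sup>2 * c\<^sup>2) / 4"
proof -
  have a: "\<bar>p * c\<bar> \<le> 1/8" using mean_le p by (simp add: abs_mult)
  have "2 * p\<^sup>2 * c\<^sup>2 = (2 * p) * (p * c\<^sup>2)" by (simp add: power2_eq_square)
  also have "\<dots> \<le> 1 * (p * c\<^sup>2)" using p by (intro mult_right_mono) auto
  finally have b: "2 * p\<^sup>2 * c\<^sup>2 \<le> p * c\<^sup>2" by simp
  have d: "0 \<le> 2 * p\<^sup>2 * c\<^sup>2" by simp
  show "5 / 64 \<le> (1 - p * c\<^sup>2 + 2 * p\<^sup>2 * c\<^sup>2) / 8 - p * c / 4"
    "5 / 64 \<le> (1 - p * c\<^sup>2 + 2 * p\<^sup>2 * c\<^sup>2) / 8 + p * c / 4"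
    "3 / 4 \<le> 1 - (1 - p * c\<^sup>2 + 2 * p\<^sup>2 * c\<^sup>2) / 4"
    using a b d var_le by argo+
qed

lemma base_pmf_wf:
  "pmf_of_list_wf (let v = 1 - p * c\<^sup>2 + 2 * p\<^sup>2 * c\<^sup>2 in
     [(2 :: real, v / 8 - p * c / 4), (0, 1 - v / 4), (-2, v / 8 + p * c / 4)])"
proof -
  have wf: "pmf_of_list_wf [(2 :: real, x), (0, y), (-2, z)]"
    if "0 \<le> x" "0 \<le> y" "0 \<le> z" "x + y + z = 1" for x y z :: real
    using that by (intro pmf_of_list_wfI) auto
  show ?thesis unfolding Let_def
    using base_pmf_bounds by (intro wf) linarith+
qed

lemma set_base_pmf: "set_pmf (base_pmf p c) \<subseteq> {2, 0, -2}"
  using set_pmf_of_list[OF base_pmf_wf] by (simp add: base_pmf_def Let_def)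

lemma pmf_base_pmf:
  "pmf (base_pmf p c) 2 = (1 - p * c\<^sup>2 + 2 * p\<^sup>2 * c\<^sup>2) / 8 - p * c / 4"
  "pmf (base_pmf p c) 0 = 1 - (1 - p * c\<^sup>2 + 2 * p\<^sup>2 * c\<^sup>2) / 4"
  "pmf (base_pmf p c) (-2) = (1 - p * c\<^sup>2 + 2 * p\<^sup>2 * c\<^sup>2) / 8 + p * c / 4"
  using pmf_pmf_of_list[OF base_pmf_wf] by (simp_all add: base_pmf_def Let_def)

lemma pmf_base_pmf_pos: "z \<in> {2, 0, -2} \<Longrightarrow> pmf (base_pmf p c) z > 0"
proof -
  have "pmf (base_pmf p c) 2 > 0" "pmf (base_pmf p c) 0 > 0" "pmf (base_pmf p c) (-2) > 0"
    unfolding pmf_base_pmf using base_pmf_bounds by linarith+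
  thus "z \<in> {2, 0, -2} \<Longrightarrow> pmf (base_pmf p c) z > 0" by auto
qed

lemma finite_base_pmf: "finite (set_pmf (base_pmf p c))"
  by (rule finite_subset[OF set_base_pmf]) simp

lemma expectation_base_pmf:
  fixes f :: "real \<Rightarrow> real"
  shows "measure_pmf.expectation (base_pmf p c) f =
    pmf (base_pmf p c) 2 * f 2 + pmf (base_pmf p c) 0 * f 0 + pmf (base_pmf p c) (-2) * f (-2)"
  using set_base_pmf by (subst integral_measure_pmf[of "{2, 0, -2}"]) (auto simp: algebra_simps)

lemma finite_contaminated_pmf: "finite (set_pmf (contaminated_pmf p c))"
  using finite_base_pmf by (auto simp: contaminated_pmf_def intro: finite_subset[OF subset_UNIV])

lemma expectation_contaminated_pmf:
  fixes f :: "real \<Rightarrow> real"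
  shows "measure_pmf.expectation (contaminated_pmf p c) f =
    p * measure_pmf.expectation (base_pmf p c) (\<lambda>z. f (z + c)) +
    (1 - p) * measure_pmf.expectation (base_pmf p c) f"
proof -
  have "measure_pmf.expectation (contaminated_pmf p c) f =
    measure_pmf.expectation (bernoulli_pmf p)
      (\<lambda>b. measure_pmf.expectation (map_pmf (\<lambda>z. z + of_bool b * c) (base_pmf p c)) f)"
    unfolding contaminated_pmf_def
    using finite_base_pmf
    by (subst pmf_expectation_bind[of UNIV]) (auto simp: integral_measure_pmf[of UNIV])
  thus ?thesis using p by (simp add: mult.commute)
qed

lemma mean_contaminated_pmf: "measure_pmf.expectation (contaminated_pmf p c) (\<lambda>w. w) = 0"
  by (simp add: expectation_contaminated_pmf expectation_base_pmf pmf_base_pmf field_simps power2_eq_square)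

lemma variance_contaminated_pmf: "measure_pmf.expectation (contaminated_pmf p c) (\<lambda>w. w\<^sup>2) = 1"
  by (simp add: expectation_contaminated_pmf expectation_base_pmf pmf_base_pmf field_simps power2_eq_square)

text \<open>For \<open>t \<le> 4\<close> the required bound is at least
  \<open>2 * exp (- 1/2) \<ge> 1\<close> and holds trivially. For larger \<open>t\<close> the base
  noise, bounded by 2, cannot reach \<open>t\<close> unshifted, and the shift occurs with
  probability \<open>p\<close> only.\<close>

lemma law_contaminated_pmf:
  assumes \<alpha>: "\<alpha> > 0" and \<tau>: "\<tau> \<ge> 4 * 2 powr (1 / \<alpha>)"
    and tail: "p \<le> exp (- (\<bar>c\<bar> powr \<alpha> / 2))"
  shows "law (contaminated_pmf p c) \<in> noise_laws \<alpha> \<tau>"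
proof -
  have \<tau>0: "\<tau> > 0" using \<tau> by (smt (verit) powr_gt_zero)
  \<comment> \<open>This inequality fixes the threshold for \<tau>; the 4 is twice the largest value
    of the base noise.\<close>
  have half: "(4 / \<tau>) powr \<alpha> \<le> 1 / 2"
  proof -
    have "(4 / \<tau>) powr \<alpha> \<le> (4 / (4 * 2 powr (1 / \<alpha>))) powr \<alpha>"
      using \<alpha> \<tau> \<tau>0 by (intro powr_mono2 divide_left_mono) auto
    also have "\<dots> = 1 / 2" using \<alpha> by (simp add: powr_divide powr_powr)
    finally show ?thesis .
  qed
  have tail_bound: "measure_pmf.prob (contaminated_pmf p c) {w. t \<le> \<bar>w\<bar>} \<le> 2 * exp (- ((t / \<tau>) powr \<alpha>))"
    if t: "t \<ge> 0" for t
  proof (cases "t \<le> 4")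
    case True
    have "(t / \<tau>) powr \<alpha> \<le> (4 / \<tau>) powr \<alpha>"
      using \<alpha> \<tau>0 t True by (intro powr_mono2 divide_right_mono) auto
    hence "exp (- (1 / 2)) \<le> exp (- ((t / \<tau>) powr \<alpha>))" using half by simp
    moreover have "(1 :: real) / 2 \<le> exp (- (1 / 2))"
      using exp_ge_add_one_self[of "- (1 / 2)"] by simp
    ultimately show ?thesis
      using measure_pmf.prob_le_1[of "contaminated_pmf p c" "{w. t \<le> \<bar>w\<bar>}"] by linarith
  next
    case False
    have "measure_pmf.prob (contaminated_pmf p c) {w. t \<le> \<bar>w\<bar>} =
        measure_pmf.expectation (contaminated_pmf p c) (indicator {w. t \<le> \<bar>w\<bar>})" by simp
    also have "\<dots> = p * measure_pmf.expectation (base_pmf p c) (\<lambda>z. indicator {w. t \<le> \<bar>w\<bar>} (z + c)) +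
       (1 - p) * measure_pmf.expectation (base_pmf p c) (indicator {w. t \<le> \<bar>w\<bar>})"
      by (rule expectation_contaminated_pmf)
    also have "measure_pmf.expectation (base_pmf p c) (indicator {w. t \<le> \<bar>w\<bar>}) = (0 :: real)"
      using False by (subst expectation_base_pmf) auto
    also have "measure_pmf.expectation (base_pmf p c) (\<lambda>z. indicator {w. t \<le> \<bar>w\<bar>} (z + c)) =
        measure_pmf.expectation (base_pmf p c) (indicator {z. t \<le> \<bar>z + c\<bar>})"
      by (intro Bochner_Integration.integral_cong) (auto simp: indicator_def)
    also have "\<dots> = measure_pmf.prob (base_pmf p c) {z. t \<le> \<bar>z + c\<bar>}" by simp
    finally have eq: "measure_pmf.prob (contaminated_pmf p c) {w. t \<le> \<bar>w\<bar>} =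
        p * measure_pmf.prob (base_pmf p c) {z. t \<le> \<bar>z + c\<bar>}" by simp
    show ?thesis
    proof (cases "t \<le> 2 + \<bar>c\<bar>")
      case True
      \<comment> \<open>From \<open>4 < t \<le> 2 + \<bar>c\<bar>\<close> follows
        \<open>\<bar>c\<bar> > 2\<close>, hence \<open>t \<le> 2 * \<bar>c\<bar>\<close>.\<close>
      have "t / \<tau> \<le> \<bar>c\<bar> * (4 / \<tau>)" 
        using True False \<tau>0 by (simp add: divide_simps)
      hence "(t / \<tau>) powr \<alpha> \<le> (\<bar>c\<bar> * (4 / \<tau>)) powr \<alpha>"
        using \<alpha> t \<tau>0 by (intro powr_mono2) auto
      also have "\<dots> = \<bar>c\<bar> powr \<alpha> * (4 / \<tau>) powr \<alpha>" by (rule powr_mult)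
      also have "\<dots> \<le> \<bar>c\<bar> powr \<alpha> * (1 / 2)" using half by (intro mult_left_mono) auto
      finally have "exp (- (\<bar>c\<bar> powr \<alpha> / 2)) \<le> exp (- ((t / \<tau>) powr \<alpha>))" by simp
      moreover have "p * measure_pmf.prob (base_pmf p c) {z. t \<le> \<bar>z + c\<bar>} \<le> p * 1"
        using p by (intro mult_left_mono measure_pmf.prob_le_1)
      ultimately show ?thesis using eq tail exp_gt_zero[of "- ((t / \<tau>) powr \<alpha>)"] by linarith
    next
      case False
      have "measure_pmf.prob (base_pmf p c) {z. t \<le> \<bar>z + c\<bar>} = 0"
        using set_base_pmf False by (subst measure_pmf_zero_iff) auto
      thus ?thesis using eq by simp
    qed
  qed
  have i: "integrable (contaminated_pmf p c) f" for f :: "real \<Rightarrow> real"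
    using finite_contaminated_pmf by (rule integrable_measure_pmf_finite)
  have moment: "has_bochner_integral (law (contaminated_pmf p c)) f (measure_pmf.expectation (contaminated_pmf p c) f)"
    if [measurable]: "f \<in> borel_measurable borel" for f :: "real \<Rightarrow> real"
    unfolding law_def has_bochner_integral_iff by (subst integrable_distr_eq, simp, fact, subst integral_distr, simp, fact, simp add: i)
  show ?thesis
    unfolding noise_laws_def mem_Collect_eq
  proof (intro conjI allI impI)
    show "prob_space (law (contaminated_pmf p c))" by (rule prob_space_law)
    show "has_bochner_integral (law (contaminated_pmf p c)) (\<lambda>w. w) 0"
      using moment[of "\<lambda>w. w"] mean_contaminated_pmf by simp
    show "has_bochner_integral (law (contaminated_pmf p c)) (\<lambda>w. w\<^sup>2) 1"
      using moment[of "\<lambda>w. w\<^sup>2"] variance_contaminated_pmf by simp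
  next
    fix t :: real assume t: "0 \<le> t"
    have "measure (law (contaminated_pmf p c)) {w. t \<le> \<bar>w\<bar>} = measure_pmf.prob (contaminated_pmf p c) {w. t \<le> \<bar>w\<bar>}"
      by (simp add: law_def measure_distr)
    thus "measure (law (contaminated_pmf p c)) {w. t \<le> \<bar>w\<bar>} \<le> 2 * exp (- ((t / \<tau>) powr \<alpha>))"
      using tail_bound[OF t] by simp
  qed simp
qed

end

lemma contamination_zero: "contamination 0 0"
  by unfold_locales auto

lemma contaminated_pmf_zero: "contaminated_pmf 0 0 = base_pmf 0 0"
proof -
  have "bernoulli_pmf 0 = return_pmf False"
    by (rule pmf_eqI) (auto simp: indicator_def)
  thus ?thesis by (simp add: contaminated_pmf_def bind_return_pmf)
qed

text \<open>Both weight vectors sum to 1, so the sum is 1 plus squared differences of weights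
  divided by weights of \<open>base_pmf p c\<close>. The differences come from the mean shift, of
  size \<open>p * \<bar>c\<bar>\<close>, and the variance shift, at most
  \<open>p * c\<^sup>2\<close>; their squares give the two terms.\<close>

lemma (in contamination) chi_square_base_pmf:
  "(\<Sum>z\<in>{2, 0, -2}. (pmf (base_pmf 0 0) z)\<^sup>2 / pmf (base_pmf p c) z) \<le> 1 + 4 * p\<^sup>2 * (c\<^sup>2 + c^4)"
proof -
  interpret z: contamination 0 0 by (rule contamination_zero)
  define u v w where "u = pmf (base_pmf p c) 2" "v = pmf (base_pmf p c) 0" "w = pmf (base_pmf p c) (-2)"
  have b: "u \<ge> 5/64" "v \<ge> 3/4" "w \<ge> 5/64" and s: "u + v + w = 1"
    using base_pmf_bounds unfolding u_v_w_def pmf_base_pmf by simp_all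
  \<comment> \<open>The terms \<open>q - x\<close> cancel in the sum over the three points. The 16
    comes from \<open>5/64 \<ge> 1/16\<close>.\<close>
  have r: "q\<^sup>2 / x \<le> q + (q - x) + 16 * (q - x)\<^sup>2" if "x \<ge> 5/64" for q x :: real
  proof -
    have "q\<^sup>2 / x = q + (q - x) + (q - x)\<^sup>2 / x"
      using that by (simp add: field_simps power2_eq_square)
    moreover have "(q - x)\<^sup>2 / x \<le> (q - x)\<^sup>2 / (1/16)"
      using that by (intro divide_left_mono) auto
    ultimately show ?thesis by simp
  qed
  \<comment> \<open>\<open>D\<close> is one minus the second moment of
    \<open>base_pmf p c\<close>.\<close>
  define D where "D = p * c\<^sup>2 - 2 * p\<^sup>2 * c\<^sup>2"
  have pc: "0 \<le> p * c\<^sup>2" "2 * p * (p * c\<^sup>2) \<le> 1 * (p * c\<^sup>2)" using p by (simp, intro mult_right_mono) auto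
  have D: "0 \<le> D" "D \<le> p * c\<^sup>2" using pc by (auto simp: D_def power2_eq_square)
  have e: "1/8 - u = D / 8 + p * c / 4" "3/4 - v = - D / 4" "1/8 - w = D / 8 - p * c / 4"
    unfolding u_v_w_def pmf_base_pmf D_def by (simp_all add: field_simps)
  have "(1/8)\<^sup>2 / u + (3/4)\<^sup>2 / v + (1/8)\<^sup>2 / w \<le> 1 + 16 * ((1/8 - u)\<^sup>2 + (3/4 - v)\<^sup>2 + (1/8 - w)\<^sup>2)"
    using r[of u "1/8"] r[of v "3/4"] r[of w "1/8"] b s by argo
  also have "16 * ((1/8 - u)\<^sup>2 + (3/4 - v)\<^sup>2 + (1/8 - w)\<^sup>2) = 3/2 * D\<^sup>2 + 2 * (p * c)\<^sup>2"
    unfolding e by (simp add: power2_eq_square field_simps)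
  also have "D\<^sup>2 \<le> (p * c\<^sup>2)\<^sup>2" using D by (rule power_mono[rotated])
  also have "1 + (3/2 * (p * c\<^sup>2)\<^sup>2 + 2 * (p * c)\<^sup>2) \<le> 1 + 4 * p\<^sup>2 * (c\<^sup>2 + c^4)"
    by (simp add: power_mult_distrib algebra_simps)
  finally show ?thesis
    unfolding u_v_w_def by (simp add: z.pmf_base_pmf add.assoc)
qed

section \<open>Product experiments and the random sparse signal\<close>

lemma expectation_prod_bernoulli:
  assumes "finite I" "J \<subseteq> I" and p: "\<And>j. j \<in> J \<Longrightarrow> 0 \<le> p j \<and> p j \<le> 1"
  shows "measure_pmf.expectation (Pi_pmf I dflt (\<lambda>j. bernoulli_pmf (p j))) (\<lambda>B. \<Prod>j\<in>J. of_bool (B j)) =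
    (\<Prod>j\<in>J. p j :: real)"
proof -
  have J: "I \<inter> J = J" using assms by auto
  have "measure_pmf.expectation (Pi_pmf I dflt (\<lambda>j. bernoulli_pmf (p j))) (\<lambda>B. \<Prod>j\<in>J. of_bool (B j) :: real) =
    measure_pmf.expectation (Pi_pmf I dflt (\<lambda>j. bernoulli_pmf (p j)))
      (\<lambda>B. \<Prod>j\<in>I. if j \<in> J then of_bool (B j) else 1)"
    using assms(1) by (simp add: prod.inter_restrict[symmetric] J)
  also have "\<dots> = (\<Prod>j\<in>I. measure_pmf.expectation (bernoulli_pmf (p j)) (\<lambda>b. if j \<in> J then of_bool b else 1))"
    by (subst expectation_prod_Pi_pmf[where f = "\<lambda>j b. if j \<in> J then of_bool b else 1"])
       (auto simp: assms(1) intro!: integrable_measure_pmf_finite)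
  also have "\<dots> = (\<Prod>j\<in>I. if j \<in> J then p j else 1)"
    using p by (intro prod.cong) auto
  finally show ?thesis using assms(1) by (simp add: prod.inter_restrict[symmetric] J)
qed

lemma finite_set_Pi_pmf:
  assumes "finite A" "\<And>x. x \<in> A \<Longrightarrow> finite (set_pmf (p x))"
  shows "finite (set_pmf (Pi_pmf A dflt p))"
  using assms by (auto simp: set_Pi_pmf)

lemma nn_integral_pmf_eq_expectation:
  fixes f :: "'a \<Rightarrow> real"
  assumes "finite (set_pmf p)" "\<And>x. f x \<ge> 0"
  shows "(\<integral>\<^sup>+ x. ennreal (f x) \<partial>measure_pmf p) = ennreal (measure_pmf.expectation p f)"
  using assms by (intro nn_integral_eq_integral integrable_measure_pmf_finite) auto

text \<open>The case \<open>P = Q\<close> of the change of measure, where the factor is 1.\<close>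

lemma expectation_square_le:
  fixes f :: "'a \<Rightarrow> real"
  assumes "finite (set_pmf p)"
  shows "(measure_pmf.expectation p f)\<^sup>2 \<le> measure_pmf.expectation p (\<lambda>x. (f x)\<^sup>2)"
  using chi_square_change_of_measure[of "set_pmf p" p p f] assms
  by (simp add: power2_eq_square sum_pmf_eq_1 pmf_positive_iff)

text \<open>The chi-square factor of a product is the product of the factors of the coordinates,
  each of the form \<open>1 + x \<le> exp x\<close>. The cost therefore adds up in the
  exponent.\<close>

lemma chi_square_Pi_base_pmf:
  assumes I: "finite I" and cont: "\<And>j. j \<in> I \<Longrightarrow> contamination (p j) (c j)"
  shows "(measure_pmf.expectation (Pi_pmf I 0 (\<lambda>j. base_pmf 0 0)) f)\<^sup>2 \<le>
    exp (\<Sum>j\<in>I. 4 * (p j)\<^sup>2 * ((c j)\<^sup>2 + c j ^ 4)) *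
    measure_pmf.expectation (Pi_pmf I 0 (\<lambda>j. base_pmf (p j) (c j))) (\<lambda>z. (f z)\<^sup>2)"
proof -
  let ?F0 = "Pi_pmf I 0 (\<lambda>j. base_pmf (p j) (c j))" and ?F1 = "Pi_pmf I 0 (\<lambda>j. base_pmf 0 0)"
  let ?S = "{2, 0, -2 :: real}"
  let ?A = "PiE_dflt I 0 (\<lambda>_. ?S)"
  have pos: "pmf (base_pmf (p j) (c j)) z > 0" if "j \<in> I" "z \<in> ?S" for j z
  proof -
    interpret contamination "p j" "c j" using cont that by blast
    show ?thesis using that pmf_base_pmf_pos by blast
  qed
  have "(measure_pmf.expectation ?F1 f)\<^sup>2 \<le>
      (\<Sum>z\<in>?A. (pmf ?F1 z)\<^sup>2 / pmf ?F0 z) * measure_pmf.expectation ?F0 (\<lambda>z. (f z)\<^sup>2)"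
  proof (rule chi_square_change_of_measure)
    show "finite ?A" using I by auto
    show "set_pmf ?F0 \<subseteq> ?A"
      using I cont contamination.set_base_pmf by (fastforce simp: set_Pi_pmf PiE_dflt_def)
    show "set_pmf ?F1 \<subseteq> ?A"
      using I contamination.set_base_pmf[OF contamination_zero] by (fastforce simp: set_Pi_pmf PiE_dflt_def)
    show "pmf ?F0 z > 0" if "z \<in> ?A" for z
      using that I pos by (subst pmf_Pi') (auto simp: PiE_dflt_def intro!: prod_pos)
  qed
  also have "(\<Sum>z\<in>?A. (pmf ?F1 z)\<^sup>2 / pmf ?F0 z) =
      (\<Sum>z\<in>?A. \<Prod>j\<in>I. (pmf (base_pmf 0 0) (z j))\<^sup>2 / pmf (base_pmf (p j) (c j)) (z j))"
    using I by (intro sum.cong) (auto simp: pmf_Pi PiE_dflt_def prod_dividef prod_power_distrib)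
  \<comment> \<open>Functions with default value 0 outside \<open>I\<close> are traded for
    extensional ones, the index set on which a sum of products factors.\<close>
  also have "\<dots> = (\<Sum>z\<in>PiE I (\<lambda>_. ?S). \<Prod>j\<in>I. (pmf (base_pmf 0 0) (z j))\<^sup>2 / pmf (base_pmf (p j) (c j)) (z j))"
    by (rule sum.reindex_bij_witness[where i = "\<lambda>h x. if x \<in> I then h x else 0" and j = "\<lambda>h. restrict h I"])
       (auto simp: PiE_dflt_def PiE_def extensional_def fun_eq_iff)
  also have "\<dots> = (\<Prod>j\<in>I. \<Sum>z\<in>?S. (pmf (base_pmf 0 0) z)\<^sup>2 / pmf (base_pmf (p j) (c j)) z)"
    using I by (subst prod_sum_PiE) auto
  also have "\<dots> \<le> (\<Prod>j\<in>I. exp (4 * (p j)\<^sup>2 * ((c j)\<^sup>2 + c j ^ 4)))"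
  proof (intro prod_mono conjI sum_nonneg)
    fix j assume "j \<in> I"
    then interpret contamination "p j" "c j" by (rule cont)
    show "(\<Sum>z\<in>?S. (pmf (base_pmf 0 0) z)\<^sup>2 / pmf (base_pmf (p j) (c j)) z) \<le>
        exp (4 * (p j)\<^sup>2 * ((c j)\<^sup>2 + c j ^ 4))"
      using chi_square_base_pmf exp_ge_add_one_self by (rule order_trans)
  qed auto
  also have "\<dots> = exp (\<Sum>j\<in>I. 4 * (p j)\<^sup>2 * ((c j)\<^sup>2 + c j ^ 4))"
    using I by (simp add: exp_sum)
  finally show ?thesis by (simp add: mult_right_mono)
qed

text \<open>Discarding the \<open>B\<close> with more than \<open>s\<close> successes costs at most
  half of the mean. For each \<open>j\<close>, the discarded part of \<open>B j\<close> is at most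
  \<open>1 / s\<close> times the number of pairs of \<open>j\<close> with another success, and its
  mean is at most \<open>p j * (s / 2) / s\<close>. First and second moments suffice.\<close>

lemma sparse_linear_mean_lower_bound:
  fixes p b :: "'a \<Rightarrow> real"
  assumes I: "finite I" and s: "s \<ge> 1" and p: "\<And>j. j \<in> I \<Longrightarrow> 0 \<le> p j \<and> p j \<le> 1"
    and sum: "(\<Sum>j\<in>I. p j) \<le> real s / 2" and b: "\<And>j. j \<in> I \<Longrightarrow> 0 \<le> b j"
  shows "(\<Sum>j\<in>I. b j * p j) / 2 \<le>
    measure_pmf.expectation (Pi_pmf I False (\<lambda>j. bernoulli_pmf (p j)))
      (\<lambda>B. of_bool (card {j\<in>I. B j} \<le> s) * (\<Sum>j\<in>I. b j * of_bool (B j)))"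
proof -
  let ?P = "Pi_pmf I False (\<lambda>j. bernoulli_pmf (p j))"
  let ?g = "\<lambda>B. of_bool (card {j\<in>I. B j} \<le> s) :: real"
  have fin: "finite (set_pmf ?P)" 
    using I by (intro finite_set_Pi_pmf) (auto intro: finite_subset[OF subset_UNIV])
  have i: "integrable ?P f" for f :: "_ \<Rightarrow> real" using fin by (rule integrable_measure_pmf_finite)
  have 1: "measure_pmf.expectation ?P (\<lambda>B. of_bool (B j)) = p j" if "j \<in> I" for j
    using expectation_prod_bernoulli[OF I, of "{j}" p False] p that by simp
  have 2: "measure_pmf.expectation ?P (\<lambda>B. of_bool (B i) * of_bool (B j)) = p i * p j"
    if "i \<in> I" "j \<in> I" "i \<noteq> j" for i j
    using expectation_prod_bernoulli[OF I, of "{i, j}" p False] p that by fastforce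
  have main: "p j / 2 \<le> measure_pmf.expectation ?P (\<lambda>B. ?g B * of_bool (B j))" if j: "j \<in> I" for j
  proof -
    have "(\<Sum>i\<in>I - {j}. p i) \<le> (\<Sum>i\<in>I. p i)" using I p by (intro sum_mono2) auto
    hence "(\<Sum>i\<in>I - {j}. p i) / s \<le> 1 / 2" using sum s by (simp add: field_simps)
    hence "p j * ((\<Sum>i\<in>I - {j}. p i) / s) \<le> p j * (1 / 2)" using p j by (intro mult_left_mono) auto
    moreover have "p j * ((\<Sum>i\<in>I - {j}. p i) / s) = (\<Sum>i\<in>I - {j}. p i * p j) / s"
      by (simp add: sum_distrib_right[symmetric])
    ultimately have "p j / 2 \<le> p j - (\<Sum>i\<in>I - {j}. p i * p j) / s" by linarith
    also have "\<dots> = measure_pmf.expectation ?P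
        (\<lambda>B. of_bool (B j) - (\<Sum>i\<in>I - {j}. of_bool (B i) * of_bool (B j)) / s)"
      using j i by (simp add: 1 2)
    also have "\<dots> \<le> measure_pmf.expectation ?P (\<lambda>B. ?g B * of_bool (B j))"
    proof (intro integral_mono i)
      fix B :: "'a \<Rightarrow> bool"
      show "of_bool (B j) - (\<Sum>i\<in>I - {j}. of_bool (B i) * of_bool (B j)) / s \<le> ?g B * of_bool (B j)"
      proof (cases "B j \<and> card {j\<in>I. B j} > s")
        case True
        \<comment> \<open>More than \<open>s\<close> successes, one of them at \<open>j\<close>,
          leave at least \<open>s\<close> at other indices, so the subtracted quotient is at least
          1.\<close>
        have "(\<Sum>i\<in>I - {j}. of_bool (B i) * of_bool (B j)) = real (card {i\<in>I - {j}. B i})"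
          using I True by (simp add: of_bool_def sum.If_cases Int_def)
        also have "{i\<in>I - {j}. B i} = {i\<in>I. B i} - {j}" by auto
        also have "real (card \<dots>) = real (card {i\<in>I. B i}) - 1"
          using True I j by (subst card_Diff_singleton) (auto simp: of_nat_diff)
        also have "\<dots> \<ge> s" using True by simp
        finally show ?thesis using s True by (simp add: field_simps)
      next
        case False
        have "(\<Sum>i\<in>I - {j}. of_bool (B i) * of_bool (B j)) / real s \<ge> 0"
          by (intro divide_nonneg_nonneg sum_nonneg) auto
        thus ?thesis using False by auto
      qed
    qed
    finally show ?thesis .
  qed
  have "(\<Sum>j\<in>I. b j * p j) / 2 = (\<Sum>j\<in>I. b j * (p j / 2))" by (simp add: sum_divide_distrib)
  also have "\<dots> \<le> (\<Sum>j\<in>I. b j * measure_pmf.expectation ?P (\<lambda>B. ?g B * of_bool (B j)))"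
    using main b by (intro sum_mono mult_left_mono) auto
  also have "\<dots> = measure_pmf.expectation ?P (\<lambda>B. \<Sum>j\<in>I. b j * (?g B * of_bool (B j)))"
    using i by simp
  also have "\<dots> = measure_pmf.expectation ?P (\<lambda>B. ?g B * (\<Sum>j\<in>I. b j * of_bool (B j)))"
    by (simp add: sum_distrib_left mult.left_commute)
  finally show ?thesis .
qed

section \<open>The general lower bound for the minimax risk\<close>

text \<open>Let \<open>R\<close> bound the risk of \<open>T\<close>, and let \<open>m\<close> be the
  mean of \<open>T\<close> given \<open>B\<close> under the uncontaminated noise. If
  \<open>B\<close> is sparse, \<open>m\<close> is within \<open>sqrt R\<close> of
  \<open>L B\<close>; the change of measure bounds \<open>m\<^sup>2\<close> by the risk at \<theta>
  = 0 given \<open>B\<close>, up to \<open>exp (8 * C)\<close>. In the constant, 4 comes from the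
  factor 1/2 lost to sparsity and 2 from squaring a sum.\<close>

lemma minimax_risk_lower_bound:
  assumes \<alpha>: "\<alpha> > 0" and \<tau>: "\<tau> \<ge> 4 * 2 powr (1 / \<alpha>)" and \<sigma>: "\<sigma> > 0" and s: "s \<ge> 1"
    and a: "\<And>j. j \<in> {1..d} \<Longrightarrow> a j \<ge> 1"
    and p: "\<And>j. j \<in> {1..d} \<Longrightarrow> 0 \<le> p j" "\<And>j. j \<in> {1..d} \<Longrightarrow> p j \<le> exp (- (a j powr \<alpha> / 2))"
      "\<And>j. j \<in> {1..d} \<Longrightarrow> p j * (a j)\<^sup>2 \<le> 1 / 8"
    and sum: "(\<Sum>j=1..d. p j) \<le> real s / 2" and chi: "(\<Sum>j=1..d. (p j)\<^sup>2 * a j ^ 4) \<le> C"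
  shows "ennreal (\<sigma>\<^sup>2 * (\<Sum>j=1..d. \<bar>\<eta> j\<bar> * a j * p j)\<^sup>2 / (8 * (1 + exp (8 * C))))
    \<le> minimax_risk d s \<eta> \<sigma> \<alpha> \<tau>"
proof -
  define I where "I = {1..d}"
  have I: "finite I" by (simp add: I_def)
  note a = a[folded I_def] and p = p[folded I_def]
  \<comment> \<open>With this sign every product \<open>\<eta> j * c j\<close> equals
    \<open>\<bar>\<eta> j\<bar> * a j\<close>, so the contributions to the functional cannot
    cancel.\<close>
  define c where "c j = sgn (\<eta> j) * a j" for j
  have c_le: "\<bar>c j\<bar> \<le> a j" if "j \<in> I" for j
    using a[OF that] by (auto simp: c_def sgn_real_def)
  have c2: "(c j)\<^sup>2 \<le> (a j)\<^sup>2" if "j \<in> I" for j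
    using c_le[OF that] by (metis abs_ge_zero power2_abs power_mono)
  have a2: "a j \<le> (a j)\<^sup>2" if "j \<in> I" for j
    using a[OF that] by (simp add: power2_eq_square)
  have pa: "p j * 1 \<le> p j * (a j)\<^sup>2" "p j * \<bar>c j\<bar> \<le> p j * (a j)\<^sup>2" "p j * (c j)\<^sup>2 \<le> p j * (a j)\<^sup>2" if "j \<in> I" for j
    using a[OF that] a2[OF that] c2[OF that] c_le[OF that] p(1)[OF that] by (intro mult_left_mono; linarith)+
  \<comment> \<open>\<open>Q0\<close> goes with \<open>\<theta> = 0\<close>, \<open>Q1\<close> with the sparse random \<open>\<theta>\<close>; \<open>Y B Z\<close> below is the common form of the data.\<close>
  have cont: "contamination (p j) (c j)" if "j \<in> I" for j
    using pa[OF that] p[OF that] by unfold_locales auto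
  have p1: "0 \<le> p j \<and> p j \<le> 1" if "j \<in> I" for j
    using contamination.p[OF cont[OF that]] by auto
  define Q0 where "Q0 = Pi\<^sub>M I (\<lambda>j. law (contaminated_pmf (p j) (c j)))"
  define Q1 where "Q1 = Pi\<^sub>M I (\<lambda>j. law (contaminated_pmf 0 0))"
  have "law (contaminated_pmf (p j) (c j)) \<in> noise_laws \<alpha> \<tau>" if "j \<in> I" for j
  proof (rule contamination.law_contaminated_pmf[OF cont[OF that] \<alpha> \<tau>])
    have "\<bar>c j\<bar> powr \<alpha> \<le> a j powr \<alpha>" using c_le[OF that] \<alpha> by (intro powr_mono2) auto
    thus "p j \<le> exp (- (\<bar>c j\<bar> powr \<alpha> / 2))" using p(2)[OF that] by (elim order_trans) simp
  qed
  hence Q0: "Q0 \<in> noise_product_laws d \<alpha> \<tau>" by (auto simp: Q0_def noise_product_laws_def I_def)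
  have "law (contaminated_pmf 0 0) \<in> noise_laws \<alpha> \<tau>"
    by (rule contamination.law_contaminated_pmf[OF contamination_zero \<alpha> \<tau>]) simp
  hence Q1: "Q1 \<in> noise_product_laws d \<alpha> \<tau>" by (auto simp: Q1_def noise_product_laws_def I_def)
  define BB where "BB = Pi_pmf I False (\<lambda>j. bernoulli_pmf (p j))"
  define F0 where "F0 = Pi_pmf I 0 (\<lambda>j. base_pmf (p j) (c j))"
  define F1 where "F1 = Pi_pmf I 0 (\<lambda>j. base_pmf 0 0)"
  have fin: "finite (set_pmf BB)" "finite (set_pmf F0)" "finite (set_pmf F1)"
    unfolding BB_def F0_def F1_def using I cont contamination_zero contamination.finite_base_pmf
    by (auto intro!: finite_set_Pi_pmf intro: finite_subset[OF subset_UNIV])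
  have int: "integrable BB f" "integrable F1 g" for f :: "_ \<Rightarrow> real" and g :: "_ \<Rightarrow> real"
    using fin by (auto intro: integrable_measure_pmf_finite)
  \<comment> \<open>\<open>L B\<close> is the functional at the signal with coordinates
    \<open>\<sigma> * (of_bool (B j) * c j)\<close>; \<open>g\<close> keeps only the
    \<open>B\<close> for which this signal is guaranteed to be sparse.\<close>
  define L where "L B = \<sigma> * (\<Sum>j\<in>I. \<bar>\<eta> j\<bar> * a j * of_bool (B j))" for B
  define g where "g B = (of_bool (card {j\<in>I. B j} \<le> s) :: real)" for B
  have gL: "\<sigma> * (\<Sum>j\<in>I. \<bar>\<eta> j\<bar> * a j * p j) / 2 \<le> measure_pmf.expectation BB (\<lambda>B. g B * L B)"
  proof -
    have "(\<Sum>j\<in>I. \<bar>\<eta> j\<bar> * a j * p j) / 2 \<le>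
      measure_pmf.expectation BB (\<lambda>B. g B * (\<Sum>j\<in>I. \<bar>\<eta> j\<bar> * a j * of_bool (B j)))"
      unfolding BB_def g_def
    proof (intro sparse_linear_mean_lower_bound I s p1)
      show "0 \<le> \<bar>\<eta> j\<bar> * a j" if "j \<in> I" for j using a[OF that] by simp
    qed (use sum in \<open>auto simp: I_def\<close>)
    hence "\<sigma> * ((\<Sum>j\<in>I. \<bar>\<eta> j\<bar> * a j * p j) / 2) \<le>
      \<sigma> * measure_pmf.expectation BB (\<lambda>B. g B * (\<Sum>j\<in>I. \<bar>\<eta> j\<bar> * a j * of_bool (B j)))"
      using \<sigma> by (intro mult_left_mono) auto
    thus ?thesis by (simp add: L_def mult.left_commute[of _ \<sigma>])
  qed
  show ?thesis
    unfolding minimax_risk_def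
  proof (rule INF_greatest)
    fix T assume T: "T \<in> estimators d"
    define r where "r = (SUP \<theta>\<in>sparse_vectors d s. SUP Q\<in>noise_product_laws d \<alpha> \<tau>. sq_risk d \<eta> \<sigma> T \<theta> Q)"
    have risk: "sq_risk d \<eta> \<sigma> T \<theta> Q \<le> r" if "\<theta> \<in> sparse_vectors d s" "Q \<in> noise_product_laws d \<alpha> \<tau>" for \<theta> Q
      unfolding r_def using that by (meson SUP_upper2 order_refl)
    have "ennreal (\<sigma>\<^sup>2 * (\<Sum>j=1..d. \<bar>\<eta> j\<bar> * a j * p j)\<^sup>2 / (8 * (1 + exp (8 * C)))) \<le> r"
    proof (cases r)
      case (real R)
      define Y where "Y B Z = (\<lambda>j\<in>I. \<sigma> * (Z j + of_bool (B j) * c j))" for B Z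
      \<comment> \<open>Risk at \<theta> = 0 given \<open>B\<close>. Only its average over
        \<open>B\<close> is a genuine risk, whereas \<open>H1\<close> holds for each sparse
        \<open>B\<close> separately, as \<theta> may depend on \<open>B\<close>.\<close>
      define r0 where "r0 B = measure_pmf.expectation F0 (\<lambda>Z. (T (Y B Z))\<^sup>2)" for B
      have r0_nonneg: "r0 B \<ge> 0" for B by (simp add: r0_def)
      have H0: "measure_pmf.expectation BB r0 \<le> R"
      proof -
        have Pi: "Pi_pmf I 0 (\<lambda>j. contaminated_pmf (p j) (c j)) =
          BB \<bind> (\<lambda>B. map_pmf (\<lambda>Z j. if j \<in> I then Z j + of_bool (B j) * c j else 0) F0)"
          unfolding contaminated_pmf_def BB_def F0_def
          by (subst Pi_pmf_bind[OF I, where d' = False], subst Pi_pmf_map_dependent[OF I, where d' = 0]) simp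
        have lin: "lin_functional d \<eta> (\<lambda>j\<in>I. 0) = 0"
          by (simp add: lin_functional_def I_def)
        have "sq_risk d \<eta> \<sigma> T (\<lambda>j\<in>I. 0) Q0 = (\<integral>\<^sup>+ B. \<integral>\<^sup>+ Z. ennreal ((T (Y B Z))\<^sup>2) \<partial>F0 \<partial>BB)"
          unfolding Q0_def I_def sq_risk_law[OF T] unfolding I_def[symmetric] Pi lin
          by (simp add: Y_def restrict_def cong: if_cong)
        also have "\<dots> = ennreal (measure_pmf.expectation BB r0)"
          using fin r0_nonneg by (simp add: nn_integral_pmf_eq_expectation r0_def[symmetric])
        finally have "ennreal (measure_pmf.expectation BB r0) \<le> ennreal R"
          using risk[OF _ Q0, of "\<lambda>j\<in>I. 0"] real by (simp add: sparse_vectors_def I_def cong: conj_cong)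
        thus ?thesis using real by simp
      qed
      have H1: "measure_pmf.expectation F1 (\<lambda>Z. (T (Y B Z) - L B)\<^sup>2) \<le> R"
        if B: "card {j\<in>I. B j} \<le> s" for B
      proof -
        define \<theta> where "\<theta> = (\<lambda>j\<in>I. \<sigma> * (of_bool (B j) * c j))"
        have "card {j\<in>I. \<theta> j \<noteq> 0} \<le> card {j\<in>I. B j}"
          using I by (intro card_mono) (auto simp: \<theta>_def)
        hence \<theta>: "\<theta> \<in> sparse_vectors d s" using B by (auto simp: sparse_vectors_def \<theta>_def I_def)
        have "lin_functional d \<eta> \<theta> = L B"
          unfolding lin_functional_def L_def sum_distrib_left I_def[symmetric]
          by (intro sum.cong) (auto simp: \<theta>_def c_def abs_sgn)
        moreover have "(\<lambda>j\<in>I. \<theta> j + \<sigma> * Z j) = Y B Z" for Z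
          by (auto simp: Y_def \<theta>_def fun_eq_iff algebra_simps)
        ultimately have "sq_risk d \<eta> \<sigma> T \<theta> Q1 = (\<integral>\<^sup>+ Z. ennreal ((T (Y B Z) - L B)\<^sup>2) \<partial>F1)"
          unfolding Q1_def I_def sq_risk_law[OF T] unfolding I_def[symmetric] contaminated_pmf_zero F1_def[symmetric]
          by simp
        also have "\<dots> = ennreal (measure_pmf.expectation F1 (\<lambda>Z. (T (Y B Z) - L B)\<^sup>2))"
          using fin by (simp add: nn_integral_pmf_eq_expectation)
        finally have "ennreal (measure_pmf.expectation F1 (\<lambda>Z. (T (Y B Z) - L B)\<^sup>2)) \<le> ennreal R"
          using risk[OF \<theta> Q1] real by simp
        thus ?thesis using real by simp
      qed
      have X: "exp (\<Sum>j\<in>I. 4 * (p j)\<^sup>2 * ((c j)\<^sup>2 + c j ^ 4)) \<le> exp (8 * C)"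
      proof -
        have "(\<Sum>j\<in>I. 4 * (p j)\<^sup>2 * ((c j)\<^sup>2 + c j ^ 4)) \<le> (\<Sum>j\<in>I. 8 * ((p j)\<^sup>2 * a j ^ 4))"
        proof (rule sum_mono)
          fix j assume j: "j \<in> I"
          have "c j ^ 4 \<le> a j ^ 4"
            using power_mono[OF c2[OF j], of 2] by simp
          moreover have "(a j)\<^sup>2 \<le> a j ^ 4" using a[OF j] by (intro power_increasing) auto
          ultimately have "4 * (p j)\<^sup>2 * ((c j)\<^sup>2 + c j ^ 4) \<le> 4 * (p j)\<^sup>2 * (2 * a j ^ 4)"
            using c2[OF j] by (intro mult_left_mono) auto
          thus "4 * (p j)\<^sup>2 * ((c j)\<^sup>2 + c j ^ 4) \<le> 8 * ((p j)\<^sup>2 * a j ^ 4)" by simp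
        qed
        also have "\<dots> \<le> 8 * C" using chi by (simp add: sum_distrib_left[symmetric] I_def)
        finally show ?thesis by simp
      qed
      have pointwise: "(g B * L B)\<^sup>2 \<le> 2 * R + 2 * exp (8 * C) * r0 B" for B
      proof (cases "card {j\<in>I. B j} \<le> s")
        case True
        define m where "m = measure_pmf.expectation F1 (\<lambda>Z. T (Y B Z))"
        have "(m - L B)\<^sup>2 = (measure_pmf.expectation F1 (\<lambda>Z. T (Y B Z) - L B))\<^sup>2"
          using int by (simp add: m_def)
        also have "\<dots> \<le> R" using expectation_square_le[OF fin(3)] H1[OF True] by (rule order_trans)
        finally have 1: "(m - L B)\<^sup>2 \<le> R" .
        have "m\<^sup>2 \<le> exp (\<Sum>j\<in>I. 4 * (p j)\<^sup>2 * ((c j)\<^sup>2 + c j ^ 4)) * r0 B"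
          unfolding m_def r0_def F0_def F1_def by (rule chi_square_Pi_base_pmf[OF I cont])
        also have "\<dots> \<le> exp (8 * C) * r0 B" using X r0_nonneg by (intro mult_right_mono)
        finally have 2: "m\<^sup>2 \<le> exp (8 * C) * r0 B" .
        \<comment> \<open>Parallelogram identity for \<open>m\<close> and \<open>m - L B\<close>,
          whose difference is \<open>L B\<close>.\<close>
        have "(L B)\<^sup>2 + (2 * m - L B)\<^sup>2 = 2 * (m - L B)\<^sup>2 + 2 * m\<^sup>2" by (simp add: power2_eq_square algebra_simps)
        hence "(L B)\<^sup>2 \<le> 2 * (m - L B)\<^sup>2 + 2 * m\<^sup>2" by (smt (verit) zero_le_power2)
        thus ?thesis using 1 2 True by (simp add: g_def)
      qed (use real r0_nonneg in \<open>auto simp: g_def\<close>)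
      have "(\<sigma> * (\<Sum>j\<in>I. \<bar>\<eta> j\<bar> * a j * p j) / 2)\<^sup>2 \<le> (measure_pmf.expectation BB (\<lambda>B. g B * L B))\<^sup>2"
        using gL \<sigma> a p(1) by (intro power_mono) (force intro!: mult_nonneg_nonneg sum_nonneg intro: order_trans[OF zero_le_one])+
      also have "\<dots> \<le> measure_pmf.expectation BB (\<lambda>B. (g B * L B)\<^sup>2)"
        by (rule expectation_square_le[OF fin(1)])
      also have "\<dots> \<le> measure_pmf.expectation BB (\<lambda>B. 2 * R + 2 * exp (8 * C) * r0 B)"
        using pointwise by (intro integral_mono int)
      also have "\<dots> = 2 * R + 2 * exp (8 * C) * measure_pmf.expectation BB r0"
        using int by simp
      also have "\<dots> \<le> 2 * R + 2 * exp (8 * C) * R"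
        using H0 by simp
      finally have "\<sigma>\<^sup>2 * (\<Sum>j\<in>I. \<bar>\<eta> j\<bar> * a j * p j)\<^sup>2 \<le> R * (8 * (1 + exp (8 * C)))"
        by (simp add: power_mult_distrib power_divide algebra_simps)
      hence "\<sigma>\<^sup>2 * (\<Sum>j\<in>I. \<bar>\<eta> j\<bar> * a j * p j)\<^sup>2 / (8 * (1 + exp (8 * C))) \<le> R"
        by (subst pos_divide_le_eq) (auto simp: add_pos_pos)
      thus ?thesis using real by (simp add: I_def ennreal_leI)
    qed simp
    thus "ennreal (\<sigma>\<^sup>2 * (\<Sum>j=1..d. \<bar>\<eta> j\<bar> * a j * p j)\<^sup>2 / (8 * (1 + exp (8 * C))))
      \<le> (SUP \<theta>\<in>sparse_vectors d s. SUP Q\<in>noise_product_laws d \<alpha> \<tau>. sq_risk d \<eta> \<sigma> T \<theta> Q)"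
      unfolding r_def .
  qed
qed

section \<open>The equations defining \<open>beta_o\<close> and \<open>lambda_H\<close>\<close>

text \<open>Expand the nonnegative double sum of
  \<open>u i * u j * ((x i - x j) * (y i - y j))\<close>: it is twice the difference of the two
  sides.\<close>

lemma chebyshev_sum_weighted:
  fixes u x y :: "'a \<Rightarrow> real"
  assumes u: "\<And>i. i \<in> I \<Longrightarrow> 0 \<le> u i"
    and xy: "\<And>i j. i \<in> I \<Longrightarrow> j \<in> I \<Longrightarrow> 0 \<le> (x i - x j) * (y i - y j)"
  shows "(\<Sum>i\<in>I. u i * x i) * (\<Sum>i\<in>I. u i * y i) \<le> (\<Sum>i\<in>I. u i) * (\<Sum>i\<in>I. u i * x i * y i)"
proof -
  have "0 \<le> (\<Sum>i\<in>I. \<Sum>j\<in>I. u i * u j * ((x i - x j) * (y i - y j)))"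
    by (intro sum_nonneg mult_nonneg_nonneg[OF mult_nonneg_nonneg] u xy)
  also have "\<dots> = (\<Sum>i\<in>I. \<Sum>j\<in>I. u i * x i * y i * u j + u i * (u j * x j * y j)
      - u i * x i * (u j * y j) - u i * y i * (u j * x j))"
    by (intro sum.cong refl) (simp add: algebra_simps)
  also have "\<dots> = (\<Sum>i\<in>I. u i * x i * y i) * (\<Sum>i\<in>I. u i) + (\<Sum>i\<in>I. u i) * (\<Sum>i\<in>I. u i * x i * y i)
      - (\<Sum>i\<in>I. u i * x i) * (\<Sum>i\<in>I. u i * y i) - (\<Sum>i\<in>I. u i * y i) * (\<Sum>i\<in>I. u i * x i)"
    by (simp only: sum_product sum.distrib sum_subtractf)
  finally show ?thesis by (simp add: mult.commute)
qed

text \<open>Raising \<beta> to \<beta>' multiplies the \<open>j\<close>-th weight by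
  \<open>r j\<close>, which is nondecreasing in \<open>\<bar>\<eta> j\<bar>\<close>. By Chebyshev's
  inequality the denominator sum \<open>V\<close>, with its extra factor
  \<open>\<bar>\<eta> j\<bar>\<close>, shrinks by no larger a factor than the numerator
  \<open>S\<close>. As \<open>S\<close> strictly decreases, \<open>S\<^sup>2 / V\<close> does
  too.\<close>

lemma beta_ratio_strict_antimono:
  fixes \<eta> :: "'a \<Rightarrow> real"
  assumes I: "finite I" "I \<noteq> {}" and \<eta>: "\<And>j. j \<in> I \<Longrightarrow> \<eta> j \<noteq> 0" and \<alpha>: "\<alpha> > 0" and less: "\<beta> < \<beta>'"
  shows "(\<Sum>j\<in>I. \<bar>\<eta> j\<bar> * exp (- \<beta>' / \<bar>\<eta> j\<bar> powr \<alpha>)) / sqrt (\<Sum>j\<in>I. (\<eta> j)\<^sup>2 * exp (- \<beta>' / \<bar>\<eta> j\<bar> powr \<alpha>))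
    < (\<Sum>j\<in>I. \<bar>\<eta> j\<bar> * exp (- \<beta> / \<bar>\<eta> j\<bar> powr \<alpha>)) / sqrt (\<Sum>j\<in>I. (\<eta> j)\<^sup>2 * exp (- \<beta> / \<bar>\<eta> j\<bar> powr \<alpha>))"
proof -
  define w where "w \<beta> j = exp (- \<beta> / \<bar>\<eta> j\<bar> powr \<alpha>)" for \<beta> j
  define S where "S \<beta> = (\<Sum>j\<in>I. \<bar>\<eta> j\<bar> * w \<beta> j)" for \<beta>
  define V where "V \<beta> = (\<Sum>j\<in>I. (\<eta> j)\<^sup>2 * w \<beta> j)" for \<beta>
  define r where "r j = exp (- (\<beta>' - \<beta>) / \<bar>\<eta> j\<bar> powr \<alpha>)" for j
  have w': "w \<beta>' j = w \<beta> j * r j" for j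
    unfolding w_def r_def exp_add[symmetric] by (simp add: diff_divide_distrib)
  have pos: "S \<beta> > 0" "V \<beta> > 0" for \<beta>
    unfolding S_def V_def w_def using I \<eta> by (auto intro!: sum_pos)
  have r_mono: "r i \<le> r j" if "i \<in> I" "j \<in> I" "\<bar>\<eta> i\<bar> \<le> \<bar>\<eta> j\<bar>" for i j
  proof -
    have "\<bar>\<eta> i\<bar> powr \<alpha> \<le> \<bar>\<eta> j\<bar> powr \<alpha>" using that \<alpha> by (intro powr_mono2) auto
    hence "(\<beta>' - \<beta>) / \<bar>\<eta> j\<bar> powr \<alpha> \<le> (\<beta>' - \<beta>) / \<bar>\<eta> i\<bar> powr \<alpha>"
      using less \<eta>[OF that(1)] \<eta>[OF that(2)] by (intro divide_left_mono) auto
    thus ?thesis unfolding r_def by (simp only: minus_divide_left[symmetric] exp_le_cancel_iff neg_le_iff_le)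
  qed
  have "(\<Sum>j\<in>I. \<bar>\<eta> j\<bar> * w \<beta> j * \<bar>\<eta> j\<bar>) * (\<Sum>j\<in>I. \<bar>\<eta> j\<bar> * w \<beta> j * r j) \<le>
     (\<Sum>j\<in>I. \<bar>\<eta> j\<bar> * w \<beta> j) * (\<Sum>j\<in>I. \<bar>\<eta> j\<bar> * w \<beta> j * \<bar>\<eta> j\<bar> * r j)"
  proof (rule chebyshev_sum_weighted)
    fix i j assume "i \<in> I" "j \<in> I"
    thus "0 \<le> (\<bar>\<eta> i\<bar> - \<bar>\<eta> j\<bar>) * (r i - r j)"
      using r_mono[of i j] r_mono[of j i]
      by (cases "\<bar>\<eta> i\<bar> \<le> \<bar>\<eta> j\<bar>") (simp_all add: mult_nonneg_nonneg mult_nonpos_nonpos)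
  qed (simp add: w_def)
  moreover have V: "V b = (\<Sum>j\<in>I. \<bar>\<eta> j\<bar> * w b j * \<bar>\<eta> j\<bar>)" for b
    unfolding V_def by (intro sum.cong refl) (metis mult.assoc mult.commute power2_abs power2_eq_square)
  moreover have "S \<beta>' = (\<Sum>j\<in>I. \<bar>\<eta> j\<bar> * w \<beta> j * r j)"
    by (simp add: S_def w' mult.assoc)
  moreover have "V \<beta>' = (\<Sum>j\<in>I. \<bar>\<eta> j\<bar> * w \<beta> j * \<bar>\<eta> j\<bar> * r j)"
    unfolding V w' by (intro sum.cong refl) (simp add: mult_ac)
  ultimately have cheb: "V \<beta> * S \<beta>' \<le> S \<beta> * V \<beta>'"
    by (simp only: S_def)
  have "S \<beta>' < S \<beta>" unfolding S_def
    using I \<eta> less by (intro sum_strict_mono) (auto simp: w_def intro!: divide_strict_right_mono)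
  hence "S \<beta>' * (S \<beta> * V \<beta>') < S \<beta> * (S \<beta> * V \<beta>')" using pos by simp
  moreover have "S \<beta>' * (V \<beta> * S \<beta>') \<le> S \<beta>' * (S \<beta> * V \<beta>')"
    using cheb pos[of \<beta>'] by (intro mult_left_mono) auto
  ultimately have "(S \<beta>')\<^sup>2 * V \<beta> < (S \<beta>)\<^sup>2 * V \<beta>'" by (simp add: power2_eq_square mult_ac)
  hence "sqrt ((S \<beta>')\<^sup>2 * V \<beta>) < sqrt ((S \<beta>)\<^sup>2 * V \<beta>')" by simp
  hence "S \<beta>' * sqrt (V \<beta>) < S \<beta> * sqrt (V \<beta>')" 
    using pos[of \<beta>] pos[of \<beta>'] by (simp add: real_sqrt_mult)
  hence "S \<beta>' / sqrt (V \<beta>') < S \<beta> / sqrt (V \<beta>)"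
    using pos[of \<beta>] pos[of \<beta>'] by (simp add: field_simps)
  thus ?thesis unfolding S_def V_def w_def .
qed

lemma ordered_weightsD:
  assumes "ordered_weights d \<eta>" "j \<in> {1..d}"
  shows "\<bar>\<eta> j\<bar> > 0" "\<bar>\<eta> j\<bar> \<le> \<bar>\<eta> 1\<bar>"
proof -
  have "\<bar>\<eta> d\<bar> \<le> \<bar>\<eta> j\<bar>" "\<bar>\<eta> d\<bar> > 0" using assms by (auto simp: ordered_weights_def)
  thus "\<bar>\<eta> j\<bar> > 0" by linarith
  show "\<bar>\<eta> j\<bar> \<le> \<bar>\<eta> 1\<bar>" using assms by (auto simp: ordered_weights_def)
qed

text \<open>Existence comes from the intermediate value theorem, uniqueness from strict
  monotonicity; together they justify the definite description.\<close>

lemma beta_o_eq: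
  assumes \<alpha>: "\<alpha> > 0" and d: "d \<ge> 1" and \<eta>: "ordered_weights d \<eta>" and s: "s \<ge> 1"
  shows "(\<Sum>j=1..d. \<bar>\<eta> j\<bar> * exp (- beta_o \<alpha> d s \<eta> / \<bar>\<eta> j\<bar> powr \<alpha>)) /
    sqrt (\<Sum>j=1..d. (\<eta> j)\<^sup>2 * exp (- beta_o \<alpha> d s \<eta> / \<bar>\<eta> j\<bar> powr \<alpha>)) = real s / 2"
proof -
  define w where "w \<beta> j = exp (- \<beta> / \<bar>\<eta> j\<bar> powr \<alpha>)" for \<beta> j
  define F where "F \<beta> = (\<Sum>j=1..d. \<bar>\<eta> j\<bar> * w \<beta> j) / sqrt (\<Sum>j=1..d. (\<eta> j)\<^sup>2 * w \<beta> j)" for \<beta>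
  define E where "E = \<bar>\<eta> 1\<bar> powr \<alpha>"
  have \<eta>0: "\<eta> j \<noteq> 0" if "j \<in> {1..d}" for j using ordered_weightsD(1)[OF \<eta> that] by auto
  have E: "\<bar>\<eta> j\<bar> powr \<alpha> \<le> E" "0 < \<bar>\<eta> j\<bar> powr \<alpha>" if "j \<in> {1..d}" for j
    unfolding E_def using ordered_weightsD[OF \<eta> that] \<alpha> by (auto intro!: powr_mono2)
  have E0: "E > 0" using less_le_trans[OF E(2)[of 1] E(1)[of 1]] d by (simp only: atLeastAtMost_iff) simp
  have wpos: "w \<beta> j > 0" for \<beta> j by (simp add: w_def)
  have Vpos: "(\<Sum>j=1..d. (\<eta> j)\<^sup>2 * w \<beta> j) > 0" for \<beta>
    using d \<eta>0 wpos by (intro sum_pos) auto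
  have cont: "continuous_on UNIV F"
    unfolding F_def w_def using Vpos[unfolded w_def] \<eta>0
    by (intro continuous_intros) (auto simp: less_imp_neq[THEN not_sym])
  \<comment> \<open>At this \<beta> every weight is at least \<open>s\<^sup>2\<close>; since the
    Euclidean norm is at most the sum norm, the ratio is at least \<open>s\<close>.\<close>
  have low: "real s / 2 \<le> F (- (2 * ln s * E))"
  proof -
    let ?b = "- (2 * ln s * E)"
    have "(real s)\<^sup>2 * ((\<eta> j)\<^sup>2 * w ?b j) \<le> (\<bar>\<eta> j\<bar> * w ?b j)\<^sup>2" if j: "j \<in> {1..d}" for j
    proof -
      have "2 * ln s * 1 \<le> 2 * ln s * (E / \<bar>\<eta> j\<bar> powr \<alpha>)"
        using E[OF j] s by (intro mult_left_mono) auto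
      hence "exp (2 * ln s) \<le> w ?b j" by (simp add: w_def)
      moreover have "exp (2 * ln s) = (real s)\<^sup>2" using s by (simp add: exp_double)
      ultimately have "(real s)\<^sup>2 * ((\<eta> j)\<^sup>2 * w ?b j) \<le> w ?b j * ((\<eta> j)\<^sup>2 * w ?b j)"
        using wpos by (intro mult_right_mono) (auto simp: less_imp_le)
      thus ?thesis by (simp add: power_mult_distrib power2_eq_square mult_ac)
    qed
    hence "(real s)\<^sup>2 * (\<Sum>j=1..d. (\<eta> j)\<^sup>2 * w ?b j) \<le> (\<Sum>j=1..d. (\<bar>\<eta> j\<bar> * w ?b j)\<^sup>2)"
      unfolding sum_distrib_left by (rule sum_mono)
    hence "sqrt ((real s)\<^sup>2 * (\<Sum>j=1..d. (\<eta> j)\<^sup>2 * w ?b j)) \<le> L2_set (\<lambda>j. \<bar>\<eta> j\<bar> * w ?b j) {1..d}"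
      by (simp add: L2_set_def)
    also have "\<dots> \<le> (\<Sum>j=1..d. \<bar>\<eta> j\<bar> * w ?b j)"
      using wpos by (intro L2_set_le_sum) (simp add: less_imp_le)
    finally have "real s * sqrt (\<Sum>j=1..d. (\<eta> j)\<^sup>2 * w ?b j) \<le> (\<Sum>j=1..d. \<bar>\<eta> j\<bar> * w ?b j)"
      by (simp add: real_sqrt_mult)
    hence "real s \<le> F ?b" unfolding F_def using Vpos[of ?b] by (simp add: pos_le_divide_eq)
    thus ?thesis by linarith
  qed
  \<comment> \<open>By Cauchy-Schwarz the ratio is at most the square root of the sum of the
    weights. Here each weight is at most \<open>1 / (4 * d)\<close>, which gives
    \<open>1 / 2 \<le> s / 2\<close>.\<close>
  have high: "F (ln (4 * d) * E) \<le> real s / 2"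
  proof -
    let ?b = "ln (4 * d) * E"
    have "w ?b j \<le> 1 / (4 * d)" if j: "j \<in> {1..d}" for j
    proof -
      have "ln (4 * d) * 1 \<le> ln (4 * d) * (E / \<bar>\<eta> j\<bar> powr \<alpha>)"
        using E[OF j] d by (intro mult_left_mono) auto
      hence "w ?b j \<le> exp (- ln (4 * d))" by (simp add: w_def)
      also have "\<dots> = 1 / (4 * d)" using d by (simp add: exp_minus inverse_eq_divide)
      finally show ?thesis .
    qed
    hence "(\<Sum>j=1..d. w ?b j) \<le> (\<Sum>j=1..d. 1 / (4 * d))" by (intro sum_mono)
    also have "\<dots> = (1 / 2)\<^sup>2" using d by (simp add: power2_eq_square)
    finally have W: "(\<Sum>j=1..d. w ?b j) \<le> (1 / 2)\<^sup>2" .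
    have "(\<Sum>j=1..d. \<bar>\<eta> j\<bar> * w ?b j)\<^sup>2 = (\<Sum>j=1..d. (\<bar>\<eta> j\<bar> * sqrt (w ?b j)) * sqrt (w ?b j))\<^sup>2"
      using wpos by (simp add: mult.assoc less_imp_le)
    also have "\<dots> \<le> (\<Sum>j=1..d. (\<bar>\<eta> j\<bar> * sqrt (w ?b j))\<^sup>2) * (\<Sum>j=1..d. (sqrt (w ?b j))\<^sup>2)"
      by (rule Cauchy_Schwarz_ineq_sum)
    also have "\<dots> = (\<Sum>j=1..d. (\<eta> j)\<^sup>2 * w ?b j) * (\<Sum>j=1..d. w ?b j)"
      using wpos by (simp add: power_mult_distrib less_imp_le)
    also have "\<dots> \<le> (\<Sum>j=1..d. (\<eta> j)\<^sup>2 * w ?b j) * (1 / 2)\<^sup>2"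
      using W Vpos[of ?b] by (intro mult_left_mono) auto
    also have "\<dots> = (sqrt (\<Sum>j=1..d. (\<eta> j)\<^sup>2 * w ?b j) * (1 / 2))\<^sup>2"
      unfolding power_mult_distrib using Vpos[of ?b] by (simp only: real_sqrt_pow2 less_imp_le)
    finally have "(\<Sum>j=1..d. \<bar>\<eta> j\<bar> * w ?b j) \<le> sqrt (\<Sum>j=1..d. (\<eta> j)\<^sup>2 * w ?b j) * (1 / 2)"
      by (rule power2_le_imp_le) (use Vpos[of ?b] in auto)
    hence "F ?b \<le> 1 / 2" unfolding F_def using Vpos[of ?b] by (simp add: pos_divide_le_eq mult.commute)
    thus ?thesis using s by linarith
  qed
  have "\<exists>\<beta>\<ge>- (2 * ln s * E). \<beta> \<le> ln (4 * d) * E \<and> F \<beta> = real s / 2"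
  proof (rule IVT2')
    have "2 * ln (real s) * E \<ge> 0" "ln (real (4 * d)) * E \<ge> 0" using s d E0 by auto
    thus "- (2 * ln s * E) \<le> ln (4 * d) * E" by linarith
  qed (use low high cont in \<open>auto intro: continuous_on_subset\<close>)
  then obtain \<beta> where \<beta>: "F \<beta> = real s / 2" by blast
  have anti: "F y < F x" if "x < y" for x y
    unfolding F_def w_def using d by (intro beta_ratio_strict_antimono \<eta>0 \<alpha> that) auto
  have "\<exists>!\<beta>. F \<beta> = real s / 2"
    using \<beta> anti by (metis linorder_neqE less_irrefl)
  hence "F (THE \<beta>. F \<beta> = real s / 2) = real s / 2" by (rule theI')
  thus ?thesis unfolding F_def w_def beta_o_def .
qed

lemma nu_o_pos:
  assumes "d \<ge> 1" "ordered_weights d \<eta>"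
  shows "nu_o \<alpha> d s \<eta> > 0"
  unfolding nu_o_def real_sqrt_gt_0_iff
proof (rule sum_pos)
  show "0 < (\<eta> j)\<^sup>2 * exp (- ((lambda_o \<alpha> d s \<eta> / \<bar>\<eta> j\<bar>) powr \<alpha>))" if "j \<in> {1..d}" for j
    using ordered_weightsD(1)[OF assms(2) that] by auto
qed (use assms in auto)

text \<open>For \<open>\<beta> < 0\<close> the truncation moves \<open>\<beta>\<close> up to 0, which lowers the ratio below \<open>s / 2\<close>.\<close>

lemma lambda_o_ratio:
  assumes \<alpha>: "\<alpha> > 0" and d: "d \<ge> 1" and \<eta>: "ordered_weights d \<eta>" and s: "s \<ge> 1"
  defines "S \<equiv> (\<Sum>j=1..d. \<bar>\<eta> j\<bar> * exp (- ((lambda_o \<alpha> d s \<eta> / \<bar>\<eta> j\<bar>) powr \<alpha>)))"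
  shows "S \<le> nu_o \<alpha> d s \<eta> * (real s / 2)"
    and "lambda_o \<alpha> d s \<eta> > 0 \<Longrightarrow> S = nu_o \<alpha> d s \<eta> * (real s / 2)"
proof -
  define b where "b = beta_o \<alpha> d s \<eta>"
  have exponent: "- ((lambda_o \<alpha> d s \<eta> / \<bar>\<eta> j\<bar>) powr \<alpha>) = - max b 0 / \<bar>\<eta> j\<bar> powr \<alpha>" for j
    using \<alpha> by (simp add: lambda_o_def b_def powr_divide powr_powr)
  have nu: "nu_o \<alpha> d s \<eta> > 0" using d \<eta> by (rule nu_o_pos)
  have ratio: "S / nu_o \<alpha> d s \<eta> = (\<Sum>j=1..d. \<bar>\<eta> j\<bar> * exp (- max b 0 / \<bar>\<eta> j\<bar> powr \<alpha>)) /
    sqrt (\<Sum>j=1..d. (\<eta> j)\<^sup>2 * exp (- max b 0 / \<bar>\<eta> j\<bar> powr \<alpha>))"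
    unfolding S_def nu_o_def exponent ..
  note eq = beta_o_eq[OF \<alpha> d \<eta> s, folded b_def]
  have eq': "S = nu_o \<alpha> d s \<eta> * (real s / 2)" if "b \<ge> 0"
  proof -
    have "S / nu_o \<alpha> d s \<eta> = real s / 2" using ratio eq that by (simp only: max_absorb1)
    thus ?thesis using nu by (simp add: field_simps)
  qed
  have "b > 0" if "lambda_o \<alpha> d s \<eta> > 0"
    using that by (auto simp: lambda_o_def b_def max_def split: if_splits)
  thus "lambda_o \<alpha> d s \<eta> > 0 \<Longrightarrow> S = nu_o \<alpha> d s \<eta> * (real s / 2)" using eq' by auto
  show "S \<le> nu_o \<alpha> d s \<eta> * (real s / 2)"
  proof (cases "b \<ge> 0")
    case False
    have "S / nu_o \<alpha> d s \<eta> < real s / 2"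
      unfolding ratio eq[symmetric] using False d
      by (intro beta_ratio_strict_antimono \<alpha>) (use ordered_weightsD(1)[OF \<eta>] in force)+
    thus ?thesis using nu by (simp add: pos_divide_less_eq mult.commute)
  qed (use eq' in simp)
qed

lemma lambda_H_eq:
  assumes \<alpha>: "\<alpha> > 0" and d: "d \<ge> 1" and \<eta>: "ordered_weights d \<eta>" and s: "s \<ge> 1" "s\<^sup>2 + s \<le> d + 1"
  shows "lambda_H \<alpha> d s \<eta> \<ge> 0"
    and "(\<Sum>j=s\<^sup>2..d. exp (- (\<bar>lambda_H \<alpha> d s \<eta> / \<eta> j\<bar> powr \<alpha>))) = real s"
proof -
  define G where "G x = (\<Sum>j=s\<^sup>2..d. exp (- (\<bar>x / \<eta> j\<bar> powr \<alpha>)))" for x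
  have sd: "s\<^sup>2 \<le> d" using s by linarith
  have s2: "s\<^sup>2 \<ge> 1" using s by simp
  have j1: "j \<in> {1..d}" if "j \<in> {s\<^sup>2..d}" for j using that s2 by auto
  note \<eta>j = ordered_weightsD[OF \<eta> j1]
  have cont: "continuous_on UNIV G"
    unfolding G_def using \<alpha> \<eta>j(1) by (intro continuous_intros continuous_on_powr') fastforce+
  \<comment> \<open>Upper end for the intermediate value theorem: at \<open>x1\<close> each summand
    is at most \<open>1 / d\<close>, so the sum is at most 1.\<close>
  define x1 where "x1 = \<bar>\<eta> 1\<bar> * ln (real d) powr (1 / \<alpha>)"
  have "exp (- (\<bar>x1 / \<eta> j\<bar> powr \<alpha>)) \<le> 1 / d" if j: "j \<in> {s\<^sup>2..d}" for j
  proof -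
    have "ln (real d) powr (1 / \<alpha>) * 1 \<le> ln (real d) powr (1 / \<alpha>) * (\<bar>\<eta> 1\<bar> / \<bar>\<eta> j\<bar>)"
      using \<eta>j[OF j] by (intro mult_left_mono) auto
    hence "ln (real d) powr (1 / \<alpha>) \<le> \<bar>x1 / \<eta> j\<bar>" by (simp add: x1_def abs_mult mult.commute)
    hence "(ln (real d) powr (1 / \<alpha>)) powr \<alpha> \<le> \<bar>x1 / \<eta> j\<bar> powr \<alpha>" using \<alpha> by (intro powr_mono2) auto
    moreover have "(ln (real d) powr (1 / \<alpha>)) powr \<alpha> = ln d" using \<alpha> d by (simp add: powr_powr)
    ultimately have "exp (- (\<bar>x1 / \<eta> j\<bar> powr \<alpha>)) \<le> exp (- ln d)" by simp
    also have "\<dots> = 1 / d" using d by (simp add: exp_minus inverse_eq_divide)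
    finally show ?thesis .
  qed
  hence "G x1 \<le> (\<Sum>j=s\<^sup>2..d. 1 / d)" unfolding G_def by (intro sum_mono)
  also have "\<dots> \<le> (\<Sum>j=1..d. 1 / d)" using s2 by (intro sum_mono2) auto
  also have "\<dots> \<le> real s" using d s by simp
  finally have high: "G x1 \<le> real s" .
  \<comment> \<open>At 0 every summand is 1 because \<open>0 powr \<alpha> = 0\<close>, and there
    are \<open>d + 1 - s\<^sup>2\<close> of them.\<close>
  have "s \<le> d + 1 - s\<^sup>2" using s by linarith
  hence low: "real s \<le> G 0" by (simp add: G_def)
  have "\<exists>x\<ge>0. x \<le> x1 \<and> G x = real s"
    using low high cont by (intro IVT2') (auto simp: x1_def intro: continuous_on_subset)
  then obtain x where x: "x \<ge> 0" "G x = real s" by blast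
  have anti: "G y < G x" if "0 \<le> x" "x < y" for x y
    unfolding G_def
  proof (rule sum_strict_mono)
    fix j assume j: "j \<in> {s\<^sup>2..d}"
    have "\<bar>x / \<eta> j\<bar> < \<bar>y / \<eta> j\<bar>" using that \<eta>j(1)[OF j] by (simp add: divide_strict_right_mono)
    thus "exp (- (\<bar>y / \<eta> j\<bar> powr \<alpha>)) < exp (- (\<bar>x / \<eta> j\<bar> powr \<alpha>))" using \<alpha> by (simp add: powr_less_mono2)
  qed (use sd in auto)
  have "\<exists>!x. x \<ge> 0 \<and> G x = real s"
    using x anti by (metis linorder_neqE less_irrefl)
  hence "(THE x. x \<ge> 0 \<and> G x = real s) \<ge> 0 \<and> G (THE x. x \<ge> 0 \<and> G x = real s) = real s" by (rule theI')
  thus "lambda_H \<alpha> d s \<eta> \<ge> 0"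
    and "(\<Sum>j=s\<^sup>2..d. exp (- (\<bar>lambda_H \<alpha> d s \<eta> / \<eta> j\<bar> powr \<alpha>))) = real s"
    unfolding G_def lambda_H_def by auto
qed

section \<open>Choice of the shifts and success probabilities\<close>

text \<open>For \<open>n \<ge> 4 / \<alpha>\<close> and \<open>x \<ge> 1\<close>,
  \<open>x ^ 4\<close> is at most \<open>(x powr \<alpha>) ^ n\<close>, and
  \<open>(1 + y / n) ^ n \<le> exp y\<close> with \<open>y = x powr \<alpha> / 2\<close> absorbs
  this power. The bound depends on \<alpha> alone, and so will the constants built from it.\<close>

lemma power4_exp_bound:
  assumes "\<alpha> > (0 :: real)"
  obtains M where "M \<ge> 1" "\<And>x. x \<ge> 1 \<Longrightarrow> x ^ 4 * exp (- (x powr \<alpha> / 2)) \<le> M"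
proof -
  define n where "n = nat \<lceil>4 / \<alpha>\<rceil>"
  have n: "real n \<ge> 4 / \<alpha>" by (simp add: n_def) linarith
  hence n0: "n > 0" using assms by (intro gr0I) auto
  have "x ^ 4 * exp (- (x powr \<alpha> / 2)) \<le> (2 * real n) ^ n" if x: "x \<ge> 1" for x :: real
  proof -
    have "x ^ 4 = x powr 4" using x powr_realpow[of x 4] by simp
    also have "\<dots> \<le> x powr (\<alpha> * n)" using x n assms by (intro powr_mono) (auto simp: field_simps)
    also have "\<dots> = (x powr \<alpha>) ^ n" using x by (simp add: powr_powr[symmetric] powr_realpow)
    also have "\<dots> = (2 * real n) ^ n * (x powr \<alpha> / 2 / n) ^ n" 
      unfolding power_mult_distrib[symmetric] using n0 by simp
    also have "\<dots> \<le> (2 * real n) ^ n * (1 + x powr \<alpha> / 2 / n) ^ n"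
      by (intro mult_left_mono power_mono) auto
    also have "\<dots> \<le> (2 * real n) ^ n * exp (x powr \<alpha> / 2)"
      using n0 by (intro mult_left_mono exp_ge_one_plus_x_over_n_power_n) (auto intro: order_trans[of _ 0])
    finally show ?thesis by (simp add: exp_minus divide_simps)
  qed
  moreover have "(2 * real n) ^ n \<ge> 1" using n0 by (intro one_le_power) simp
  ultimately show ?thesis using that[of "(2 * real n) ^ n"] by blast
qed

lemma minimax_risk_lower_boundI:
  assumes "\<alpha> > 0" "\<tau> \<ge> 4 * 2 powr (1 / \<alpha>)" "\<sigma> > 0" "s \<ge> 1"
    and "\<And>j. j \<in> {1..d} \<Longrightarrow> a j \<ge> 1"
    and "\<And>j. j \<in> {1..d} \<Longrightarrow> 0 \<le> p j" "\<And>j. j \<in> {1..d} \<Longrightarrow> p j \<le> exp (- (a j powr \<alpha> / 2))"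
      "\<And>j. j \<in> {1..d} \<Longrightarrow> p j * (a j)\<^sup>2 \<le> 1 / 8"
    and "(\<Sum>j=1..d. p j) \<le> real s / 2" "(\<Sum>j=1..d. (p j)\<^sup>2 * a j ^ 4) \<le> C"
    and K: "0 \<le> K" "K \<le> (\<Sum>j=1..d. \<bar>\<eta> j\<bar> * a j * p j)"
  shows "ennreal (\<sigma>\<^sup>2 * K\<^sup>2 / (8 * (1 + exp (8 * C)))) \<le> minimax_risk d s \<eta> \<sigma> \<alpha> \<tau>"
proof -
  have "0 < 8 * (1 + exp (8 * C))" by (simp add: add_pos_pos)
  moreover have "\<sigma>\<^sup>2 * K\<^sup>2 \<le> \<sigma>\<^sup>2 * (\<Sum>j=1..d. \<bar>\<eta> j\<bar> * a j * p j)\<^sup>2"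
    using K by (intro mult_left_mono power_mono) auto
  ultimately have "\<sigma>\<^sup>2 * K\<^sup>2 / (8 * (1 + exp (8 * C))) \<le>
      \<sigma>\<^sup>2 * (\<Sum>j=1..d. \<bar>\<eta> j\<bar> * a j * p j)\<^sup>2 / (8 * (1 + exp (8 * C)))"
    by (intro divide_right_mono) auto
  thus ?thesis
    by (rule order_trans[OF ennreal_leI minimax_risk_lower_bound]) (fact assms)+
qed

lemma half_le_exp: "1 / 2 \<le> exp (- (1 / 2) :: real)"
  using exp_ge_add_one_self[of "- (1 / 2) :: real"] by simp

text \<open>With these \<open>p\<close>, the sum of \<open>\<bar>\<eta> j\<bar> * p j\<close> is
  \<open>\<kappa> * nu\<close> by definition of \<open>nu\<close>, and \<open>lam\<close> times the
  sum of \<open>p j\<close> is \<open>\<kappa> * lam * s / 2\<close> by the equation for \<beta>.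
  Both are below the separation because \<open>\<bar>\<eta> j\<bar> * a j\<close> dominates
  \<open>\<bar>\<eta> j\<bar>\<close> and \<open>lam\<close>.\<close>

lemma minimax_risk_ge_Phi_o:
  assumes \<alpha>: "\<alpha> > 0" and \<tau>: "\<tau> \<ge> 4 * 2 powr (1 / \<alpha>)" and d: "d \<ge> 1" and \<eta>: "ordered_weights d \<eta>"
    and \<sigma>: "\<sigma> > 0" and s: "s \<ge> 1"
    and M: "M \<ge> 1" "\<And>x. x \<ge> 1 \<Longrightarrow> x ^ 4 * exp (- (x powr \<alpha> / 2)) \<le> M"
  defines "\<kappa> \<equiv> 1 / (16 * M)"
  shows "ennreal (\<kappa>\<^sup>2 / (72 * (1 + exp 8)) * \<sigma>\<^sup>2 * Phi_o \<alpha> d s \<eta>) \<le> minimax_risk d s \<eta> \<sigma> \<alpha> \<tau>"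
proof -
  define lam where "lam = lambda_o \<alpha> d s \<eta>"
  define nu where "nu = nu_o \<alpha> d s \<eta>"
  define x where "x j = lam / \<bar>\<eta> j\<bar>" for j
  define w where "w j = exp (- (x j powr \<alpha>))" for j
  define a where "a j = max (x j) 1" for j
  define p where "p j = \<kappa> * \<bar>\<eta> j\<bar> * w j / nu" for j
  have \<kappa>: "0 < \<kappa>" "\<kappa> \<le> 1 / 16" "\<kappa> * M = 1 / 16" using M by (auto simp: \<kappa>_def field_simps)
  have lam: "lam \<ge> 0" by (simp add: lam_def lambda_o_def)
  have nu: "nu > 0" unfolding nu_def using d \<eta> by (rule nu_o_pos)
  have wpos: "w j > 0" for j by (simp add: w_def)
  have nu2: "nu\<^sup>2 = (\<Sum>j=1..d. (\<eta> j)\<^sup>2 * w j)"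
    unfolding nu_def nu_o_def w_def x_def lam_def by (rule real_sqrt_pow2) (simp add: sum_nonneg)
  have \<eta>0: "\<bar>\<eta> j\<bar> > 0" if "j \<in> {1..d}" for j using ordered_weightsD(1)[OF \<eta> that] .
  have a1: "a j \<ge> 1" for j by (simp add: a_def)
  have p0: "0 \<le> p j" for j using \<kappa> wpos[of j] nu by (simp add: p_def)
  have sqrt_w: "sqrt (w j) = exp (- (x j powr \<alpha> / 2))" for j
    by (rule real_sqrt_unique) (auto simp: w_def power2_eq_square simp flip: exp_add)
  \<comment> \<open>Truncating \<open>x j\<close> from below at 1 costs a factor
    \<open>exp (1/2) \<le> 2\<close>.\<close>
  have sqrt_w_le: "sqrt (w j) \<le> 2 * exp (- (a j powr \<alpha> / 2))" for j
  proof -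
    have "a j powr \<alpha> \<le> x j powr \<alpha> + 1" by (simp add: a_def max_def)
    hence "exp (- (x j powr \<alpha> / 2)) * exp (- (1 / 2)) \<le> exp (- (a j powr \<alpha> / 2))"
      by (simp flip: exp_add)
    moreover have "exp (- (x j powr \<alpha> / 2)) * (1 / 2) \<le> exp (- (x j powr \<alpha> / 2)) * exp (- (1 / 2))"
      by (intro mult_left_mono half_le_exp) auto
    ultimately show ?thesis unfolding sqrt_w by linarith
  qed
  \<comment> \<open>A single summand of \<open>nu\<^sup>2\<close> is at most the whole, so
    \<open>p j\<close> decays at least like \<open>sqrt (w j)\<close>. This is why the tail
    condition carries half of the exponent.\<close>
  have p_le_sqrt: "p j \<le> \<kappa> * sqrt (w j)" if j: "j \<in> {1..d}" for j
  proof -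
    have "(\<bar>\<eta> j\<bar> * sqrt (w j))\<^sup>2 = (\<eta> j)\<^sup>2 * w j" using wpos[of j] by (simp add: power_mult_distrib)
    also have "\<dots> \<le> nu\<^sup>2" unfolding nu2 using j wpos
      by (intro member_le_sum) (auto simp: less_imp_le)
    finally have "\<bar>\<eta> j\<bar> * sqrt (w j) \<le> nu" by (rule power2_le_imp_le) (use nu in auto)
    hence "\<kappa> * sqrt (w j) * (\<bar>\<eta> j\<bar> * sqrt (w j)) \<le> \<kappa> * sqrt (w j) * nu"
      using \<kappa> wpos[of j] by (intro mult_left_mono) auto
    moreover have "\<kappa> * sqrt (w j) * (\<bar>\<eta> j\<bar> * sqrt (w j)) = \<kappa> * \<bar>\<eta> j\<bar> * w j"
      using wpos[of j] by (simp add: mult_ac less_imp_le)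
    ultimately show ?thesis using nu by (simp add: p_def pos_divide_le_eq)
  qed
  have p_le: "p j \<le> 2 * \<kappa> * exp (- (a j powr \<alpha> / 2))" if "j \<in> {1..d}" for j
    using p_le_sqrt[OF that] mult_left_mono[OF sqrt_w_le[of j], of \<kappa>] \<kappa> by linarith
  have a4: "exp (- (a j powr \<alpha> / 2)) * a j ^ 4 \<le> M" for j
    using M(2)[OF a1[of j]] by (simp add: mult.commute)
  have wa4: "w j * a j ^ 4 \<le> 4 * M" for j
  proof -
    let ?e = "exp (- (a j powr \<alpha> / 2))"
    have "w j = (sqrt (w j))\<^sup>2" using wpos[of j] by simp
    also have "\<dots> \<le> (2 * ?e)\<^sup>2" using sqrt_w_le[of j] wpos[of j] by (intro power_mono) auto
    also have "\<dots> = 4 * ?e * ?e" by (simp add: power2_eq_square)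
    also have "\<dots> \<le> 4 * ?e * 1" by (intro mult_left_mono) auto
    finally have "w j * a j ^ 4 \<le> 4 * ?e * a j ^ 4" by (intro mult_right_mono) auto
    thus ?thesis using a4[of j] by simp
  qed
  have exponent: "- ((lambda_o \<alpha> d s \<eta> / \<bar>\<eta> j\<bar>) powr \<alpha>) = - (x j powr \<alpha>)" for j
    by (simp add: x_def lam_def)
  note ratio = lambda_o_ratio[OF \<alpha> d \<eta> s, unfolded exponent, folded w_def lam_def nu_def]
  \<comment> \<open>The separation is at least \<open>\<kappa> * nu\<close> and at least
    \<open>\<kappa> * lam * s / 2\<close>; adding the first bound to twice the second explains the
    3.\<close>
  have gain: "\<kappa> * (lam * real s + nu) / 3 \<le> (\<Sum>j=1..d. \<bar>\<eta> j\<bar> * a j * p j)"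
  proof -
    have "\<kappa> * nu = (\<Sum>j=1..d. \<kappa> * ((\<eta> j)\<^sup>2 * w j)) / nu"
      unfolding sum_distrib_left[symmetric] nu2[symmetric]
      using nu by (simp add: power2_eq_square)
    also have "\<dots> = (\<Sum>j=1..d. \<bar>\<eta> j\<bar> * 1 * p j)"
      unfolding sum_divide_distrib p_def
      by (intro sum.cong refl) (simp add: power2_eq_square abs_mult_self_eq flip: abs_mult)
    also have "\<dots> \<le> (\<Sum>j=1..d. \<bar>\<eta> j\<bar> * a j * p j)"
      using a1 p0 by (intro sum_mono mult_right_mono mult_left_mono) auto
    finally have 1: "\<kappa> * nu \<le> (\<Sum>j=1..d. \<bar>\<eta> j\<bar> * a j * p j)" .
    \<comment> \<open>For \<open>lam = 0\<close> the equation for the ratio may fail, but then both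
      sides vanish.\<close>
    have eq: "lam * (\<Sum>j=1..d. \<bar>\<eta> j\<bar> * w j) = lam * (nu * (real s / 2))"
      using ratio(2) lam by (cases "lam = 0") auto
    have "\<kappa> * (lam * real s / 2) = \<kappa> * (lam * (\<Sum>j=1..d. \<bar>\<eta> j\<bar> * w j)) / nu"
      unfolding eq using nu by simp
    also have "\<dots> = (\<Sum>j=1..d. lam * p j)"
      by (simp add: p_def sum_distrib_left sum_divide_distrib mult_ac)
    also have "\<dots> \<le> (\<Sum>j=1..d. \<bar>\<eta> j\<bar> * a j * p j)"
    proof (intro sum_mono mult_right_mono p0)
      fix j assume j: "j \<in> {1..d}"
      have "lam = \<bar>\<eta> j\<bar> * x j" using \<eta>0[OF j] by (simp add: x_def)
      also have "\<dots> \<le> \<bar>\<eta> j\<bar> * a j" by (intro mult_left_mono) (auto simp: a_def)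
      finally show "lam \<le> \<bar>\<eta> j\<bar> * a j" .
    qed
    finally show ?thesis using 1 by (simp add: distrib_left)
  qed
  have "ennreal (\<sigma>\<^sup>2 * (\<kappa> * (lam * real s + nu) / 3)\<^sup>2 / (8 * (1 + exp (8 * 1)))) \<le> minimax_risk d s \<eta> \<sigma> \<alpha> \<tau>"
  proof (rule minimax_risk_lower_boundI[OF \<alpha> \<tau> \<sigma> s a1 p0 _ _ _ _ _ gain])
    show "0 \<le> \<kappa> * (lam * real s + nu) / 3" using \<kappa> lam nu by simp
  next
    fix j assume j: "j \<in> {1..d}"
    have "2 * \<kappa> * exp (- (a j powr \<alpha> / 2)) \<le> 1 * exp (- (a j powr \<alpha> / 2))"
      using \<kappa> by (intro mult_right_mono) auto
    thus "p j \<le> exp (- (a j powr \<alpha> / 2))" using p_le[OF j] by linarith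
    have "p j * (a j)\<^sup>2 \<le> p j * a j ^ 4" using a1[of j] p0 by (intro mult_left_mono power_increasing) auto
    also have "\<dots> \<le> 2 * \<kappa> * exp (- (a j powr \<alpha> / 2)) * a j ^ 4" using p_le[OF j] by (intro mult_right_mono) auto
    also have "\<dots> = 2 * \<kappa> * (exp (- (a j powr \<alpha> / 2)) * a j ^ 4)" by (simp add: mult.assoc)
    also have "\<dots> \<le> 2 * \<kappa> * M" using a4 \<kappa> by (intro mult_left_mono) auto
    finally show "p j * (a j)\<^sup>2 \<le> 1 / 8" using \<kappa> by simp
  next
    have "(\<Sum>j=1..d. p j) = \<kappa> * ((\<Sum>j=1..d. \<bar>\<eta> j\<bar> * w j) / nu)"
      by (simp add: p_def sum_distrib_left sum_divide_distrib mult.assoc)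
    also have "\<dots> \<le> 1 * (real s / 2)"
      using ratio(1) nu \<kappa> wpos by (intro mult_mono) (auto simp: pos_divide_le_eq mult.commute intro!: divide_nonneg_nonneg sum_nonneg simp: less_imp_le)
    finally show "(\<Sum>j=1..d. p j) \<le> real s / 2" by simp
  next
    \<comment> \<open>One factor \<open>w j\<close> tames \<open>a j ^ 4\<close>; the other stays
      with \<open>(\<eta> j)\<^sup>2\<close> and sums to \<open>nu\<^sup>2\<close>, which
      cancels.\<close>
    have "(p j)\<^sup>2 * a j ^ 4 \<le> 4 * M * \<kappa>\<^sup>2 / nu\<^sup>2 * ((\<eta> j)\<^sup>2 * w j)" for j
    proof -
      have "(p j)\<^sup>2 * a j ^ 4 = \<kappa>\<^sup>2 / nu\<^sup>2 * ((\<eta> j)\<^sup>2 * w j) * (w j * a j ^ 4)"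
        by (simp add: p_def power_divide power_mult_distrib power2_eq_square[of "w j"])
      also have "\<dots> \<le> \<kappa>\<^sup>2 / nu\<^sup>2 * ((\<eta> j)\<^sup>2 * w j) * (4 * M)"
        using wa4 wpos[of j] by (intro mult_left_mono) auto
      finally show ?thesis by (simp add: mult_ac)
    qed
    hence "(\<Sum>j=1..d. (p j)\<^sup>2 * a j ^ 4) \<le> (\<Sum>j=1..d. 4 * M * \<kappa>\<^sup>2 / nu\<^sup>2 * ((\<eta> j)\<^sup>2 * w j))" by (intro sum_mono)
    also have "\<dots> = 4 * M * \<kappa>\<^sup>2" unfolding sum_distrib_left[symmetric] nu2[symmetric] using nu by simp
    also have "\<dots> = 4 * (\<kappa> * M) * \<kappa>" by (simp add: power2_eq_square)
    also have "\<dots> \<le> 1" unfolding \<kappa>(3) using \<kappa> by simp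
    finally show "(\<Sum>j=1..d. (p j)\<^sup>2 * a j ^ 4) \<le> 1" .
  qed
  also have "\<sigma>\<^sup>2 * (\<kappa> * (lam * real s + nu) / 3)\<^sup>2 / (8 * (1 + exp (8 * 1))) =
      \<kappa>\<^sup>2 / (72 * (1 + exp 8)) * \<sigma>\<^sup>2 * Phi_o \<alpha> d s \<eta>"
    unfolding Phi_o_def lam_def[symmetric] nu_def[symmetric] power_mult_distrib power_divide
    by (simp add: distrib_left)
  finally show ?thesis .
qed

lemma sum_if_mem:
  assumes "finite A" "B \<subseteq> A"
  shows "(\<Sum>j\<in>A. if j \<in> B then f j else (0 :: real)) = sum f B"
  using assms by (simp add: sum.inter_restrict[symmetric] Int_absorb1)

text \<open>Every index used contributes at least \<open>lam * p j\<close> to the separation. The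
  chi-square cost is at most \<open>C\<close> in the first case and 1 in the second, hence
  \<open>max C 1\<close>; \<open>\<kappa> * M = 1 / 8\<close> yields the variance condition in the
  first case.\<close>

lemma minimax_risk_ge_lambda_H:
  assumes \<alpha>: "\<alpha> > 0" and \<tau>: "\<tau> \<ge> 4 * 2 powr (1 / \<alpha>)" and d: "d \<ge> 1" and \<eta>: "ordered_weights d \<eta>"
    and \<sigma>: "\<sigma> > 0" and s: "s \<ge> 1" "s\<^sup>2 + s \<le> d + 1"
    and M: "M \<ge> 1" "\<And>x. x \<ge> 1 \<Longrightarrow> x ^ 4 * exp (- (x powr \<alpha> / 2)) \<le> M"
    and C: "(\<Sum>j=s\<^sup>2..d. lambda_H \<alpha> d s \<eta> ^ 4 / \<eta> j ^ 4 *
          exp (- 2 * \<bar>lambda_H \<alpha> d s \<eta> / \<eta> j\<bar> powr \<alpha>)) \<le> C"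
  defines "\<kappa> \<equiv> 1 / (8 * M)"
  shows "ennreal (\<kappa>\<^sup>2 / (32 * (1 + exp (8 * max C 1))) * \<sigma>\<^sup>2 * (real s)\<^sup>2 * (lambda_H \<alpha> d s \<eta>)\<^sup>2)
    \<le> minimax_risk d s \<eta> \<sigma> \<alpha> \<tau>"
proof -
  define lam where "lam = lambda_H \<alpha> d s \<eta>"
  define w where "w j = exp (- ((lam / \<bar>\<eta> j\<bar>) powr \<alpha>))" for j
  have lam: "lam \<ge> 0" unfolding lam_def using \<alpha> d \<eta> s by (rule lambda_H_eq)
  have \<kappa>: "0 < \<kappa>" "\<kappa> \<le> 1 / 8" "\<kappa> * M = 1 / 8" using M by (auto simp: \<kappa>_def field_simps)
  have sd: "s\<^sup>2 \<le> d" using s by linarith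
  have s2: "s\<^sup>2 \<ge> 1" using s by simp
  have \<eta>0: "\<bar>\<eta> j\<bar> > 0" if "j \<in> {1..d}" for j using ordered_weightsD(1)[OF \<eta> that] .
  have abs: "\<bar>lambda_H \<alpha> d s \<eta> / \<eta> j\<bar> = lam / \<bar>\<eta> j\<bar>" for j
    using lam by (simp add: lam_def)
  have sum_w: "(\<Sum>j=s\<^sup>2..d. w j) = real s"
    using lambda_H_eq(2)[OF \<alpha> d \<eta> s] unfolding abs w_def .
  \<comment> \<open>On these indices \<open>lam / \<bar>\<eta> j\<bar> \<ge> 1\<close>, as required
    of a shift.\<close>
  define J where "J = {j \<in> {s\<^sup>2..d}. \<bar>\<eta> j\<bar> \<le> lam}"
  have J: "finite J" "J \<subseteq> {1..d}" "J \<subseteq> {s\<^sup>2..d}" using s2 by (auto simp: J_def)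
  have "ennreal (\<sigma>\<^sup>2 * (\<kappa> * lam * real s / 2)\<^sup>2 / (8 * (1 + exp (8 * max C 1)))) \<le> minimax_risk d s \<eta> \<sigma> \<alpha> \<tau>"
  proof (cases "real s / 2 \<le> sum w J")
    case True
    define a where "a j = (if j \<in> J then lam / \<bar>\<eta> j\<bar> else 1)" for j
    define p where "p j = (if j \<in> J then \<kappa> * w j else 0)" for j
    have wJ: "sum w J \<le> real s"
      unfolding sum_w[symmetric] using J by (intro sum_mono2) (auto simp: w_def)
    have a1: "a j \<ge> 1" if "j \<in> {1..d}" for j
      using \<eta>0[OF that] by (auto simp: a_def J_def)
    have p0: "0 \<le> p j" for j using \<kappa> by (simp add: p_def w_def)
    have p_le: "p j \<le> \<kappa> * exp (- (a j powr \<alpha> / 2))" for j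
      using \<kappa> by (auto simp: p_def a_def w_def)
    show ?thesis
    proof (rule minimax_risk_lower_boundI[OF \<alpha> \<tau> \<sigma> s(1) a1 p0])
      fix j assume j: "j \<in> {1..d}"
      have "\<kappa> * exp (- (a j powr \<alpha> / 2)) \<le> 1 * exp (- (a j powr \<alpha> / 2))"
        using \<kappa> by (intro mult_right_mono) auto
      thus "p j \<le> exp (- (a j powr \<alpha> / 2))" using p_le[of j] by linarith
      have "p j * (a j)\<^sup>2 \<le> p j * a j ^ 4" using a1[OF j] p0 by (intro mult_left_mono power_increasing) auto
      also have "\<dots> \<le> \<kappa> * exp (- (a j powr \<alpha> / 2)) * a j ^ 4" using p_le by (intro mult_right_mono) auto
      also have "\<dots> = \<kappa> * (a j ^ 4 * exp (- (a j powr \<alpha> / 2)))" by (simp add: mult_ac)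
      also have "\<dots> \<le> \<kappa> * M" using M(2)[OF a1[OF j]] \<kappa> by (intro mult_left_mono) auto
      finally show "p j * (a j)\<^sup>2 \<le> 1 / 8" using \<kappa> by simp
    next
      have "(\<Sum>j=1..d. p j) = \<kappa> * sum w J"
        using J by (simp add: p_def sum_if_mem sum_distrib_left)
      also have "\<dots> \<le> 1 / 8 * real s" using \<kappa> wJ by (intro mult_mono) (auto simp: w_def sum_nonneg)
      finally show "(\<Sum>j=1..d. p j) \<le> real s / 2" by simp
    next
      define h where "h j = lam ^ 4 / \<eta> j ^ 4 * exp (- 2 * (lam / \<bar>\<eta> j\<bar>) powr \<alpha>)" for j
      have h0: "h j \<ge> 0" for j by (simp add: h_def)
      have "(\<Sum>j=1..d. (p j)\<^sup>2 * a j ^ 4) = (\<Sum>j=1..d. if j \<in> J then \<kappa>\<^sup>2 * h j else 0)"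
      proof (intro sum.cong refl)
        fix j
        have "(w j)\<^sup>2 = exp (- 2 * (lam / \<bar>\<eta> j\<bar>) powr \<alpha>)"
          by (simp add: w_def power2_eq_square flip: exp_add)
        thus "(p j)\<^sup>2 * a j ^ 4 = (if j \<in> J then \<kappa>\<^sup>2 * h j else 0)"
          by (simp add: p_def a_def h_def power_mult_distrib power_divide)
      qed
      also have "\<dots> = \<kappa>\<^sup>2 * sum h J" using J by (simp add: sum_if_mem sum_distrib_left)
      also have "\<dots> \<le> 1 * sum h {s\<^sup>2..d}"
        using J h0 \<kappa> by (intro mult_mono sum_mono2 sum_nonneg) (auto simp: power_le_one)
      also have "\<dots> \<le> C" using C[unfolded abs, folded lam_def] by (simp add: h_def[abs_def])
      finally show "(\<Sum>j=1..d. (p j)\<^sup>2 * a j ^ 4) \<le> max C 1" by simp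
    next
      show "0 \<le> \<kappa> * lam * real s / 2" using \<kappa> lam by simp
      have "\<kappa> * lam * real s / 2 \<le> \<kappa> * lam * sum w J"
        using True mult_left_mono[OF True, of "\<kappa> * lam"] \<kappa> lam by simp
      also have "\<dots> = (\<Sum>j=1..d. if j \<in> J then \<kappa> * lam * w j else 0)"
        using J by (simp add: sum_if_mem sum_distrib_left)
      also have "\<dots> = (\<Sum>j=1..d. \<bar>\<eta> j\<bar> * a j * p j)"
        using \<eta>0 by (intro sum.cong refl) (force simp: a_def p_def)
      finally show "\<kappa> * lam * real s / 2 \<le> (\<Sum>j=1..d. \<bar>\<eta> j\<bar> * a j * p j)" .
    qed
  next
    case False
    \<comment> \<open>Otherwise \<open>J\<close> would carry the full sum \<open>s\<close>. An index
      outside \<open>J\<close> has weight above \<open>lam\<close>, and by the ordering so have all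
      indices up to \<open>s\<^sup>2\<close>.\<close>
    have "J \<noteq> {s\<^sup>2..d}" using False sum_w s by auto
    then obtain k where k: "k \<in> {s\<^sup>2..d}" "\<bar>\<eta> k\<bar> > lam" by (force simp: J_def)
    have large: "lam \<le> \<bar>\<eta> j\<bar>" if "j \<in> {1..s\<^sup>2}" for j
    proof -
      have "\<bar>\<eta> k\<bar> \<le> \<bar>\<eta> j\<bar>" using \<eta> k that sd by (auto simp: ordered_weights_def)
      thus ?thesis using k by linarith
    qed
    \<comment> \<open>On \<open>s\<^sup>2\<close> indices this gives \<open>\<kappa> * s\<close>
      expected successes at a chi-square cost of only \<open>\<kappa>\<^sup>2\<close>.\<close>
    define p where "p j = (if j \<in> {1..s\<^sup>2} then \<kappa> / real s else 0)" for j
    have sub: "{1..s\<^sup>2} \<subseteq> {1..d}" using sd by auto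
    have ps: "0 \<le> \<kappa> / s" "\<kappa> / s \<le> 1 / 8"
      using \<kappa> s frac_le[of "1/8" \<kappa> 1 "real s"] by auto
    show ?thesis
    proof (rule minimax_risk_lower_boundI[where a = "\<lambda>_. 1", OF \<alpha> \<tau> \<sigma> s(1)])
      fix j assume "j \<in> {1..d}"
      show "0 \<le> p j" "p j * 1\<^sup>2 \<le> 1 / 8" using ps by (auto simp: p_def)
      have "\<kappa> / s \<le> exp (- (1 / 2))" using ps half_le_exp by linarith
      thus "p j \<le> exp (- (1 powr \<alpha> / 2))" by (auto simp: p_def)
    next
      have "(\<Sum>j=1..d. p j) = \<kappa> * real s"
        unfolding p_def using sub s by (subst sum_if_mem) (auto simp: power2_eq_square)
      also have "\<dots> \<le> 1 / 2 * real s" using \<kappa> by (intro mult_right_mono) auto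
      finally show "(\<Sum>j=1..d. p j) \<le> real s / 2" by simp
    next
      have "(\<Sum>j=1..d. (p j)\<^sup>2 * 1 ^ 4) = (\<Sum>j=1..d. if j \<in> {1..s\<^sup>2} then (\<kappa> / real s)\<^sup>2 else 0)"
        by (intro sum.cong refl) (auto simp: p_def)
      also have "\<dots> = \<kappa>\<^sup>2" using sub s by (subst sum_if_mem) (auto simp: power_divide)
      also have "\<dots> \<le> 1" using \<kappa> by (intro power_le_one) auto
      finally show "(\<Sum>j=1..d. (p j)\<^sup>2 * 1 ^ 4) \<le> max C 1" by simp
    next
      show "0 \<le> \<kappa> * lam * real s / 2" using \<kappa> lam by simp
      hence "\<kappa> * lam * real s / 2 \<le> \<kappa> * lam * real s" by linarith
      also have "\<dots> = (\<Sum>j\<in>{1..s\<^sup>2}. lam * (\<kappa> / real s))" using s by (simp add: power2_eq_square)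
      also have "\<dots> = (\<Sum>j=1..d. if j \<in> {1..s\<^sup>2} then lam * (\<kappa> / real s) else 0)"
        using sub by (subst sum_if_mem) auto
      also have "\<dots> \<le> (\<Sum>j=1..d. \<bar>\<eta> j\<bar> * 1 * p j)"
        using large ps by (intro sum_mono) (auto simp: p_def intro!: mult_right_mono simp del: times_divide_eq_right)
      finally show "\<kappa> * lam * real s / 2 \<le> (\<Sum>j=1..d. \<bar>\<eta> j\<bar> * 1 * p j)" .
    qed simp
  qed
  also have "\<sigma>\<^sup>2 * (\<kappa> * lam * real s / 2)\<^sup>2 / (8 * (1 + exp (8 * max C 1))) =
      \<kappa>\<^sup>2 / (32 * (1 + exp (8 * max C 1))) * \<sigma>\<^sup>2 * (real s)\<^sup>2 * (lambda_H \<alpha> d s \<eta>)\<^sup>2"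
    unfolding lam_def[symmetric] power_mult_distrib power_divide
    by (simp add: distrib_left mult_ac)
  finally show ?thesis .
qed

theorem theorem5:
  fixes \<alpha> :: real
  assumes "\<alpha> > 0"
  shows "\<exists>\<tau>\<^sub>\<alpha>>0. \<exists>c>0. \<forall>\<tau>\<ge>\<tau>\<^sub>\<alpha>.
    (\<forall>(d::nat) (\<eta>::nat \<Rightarrow> real) (\<sigma>::real) (s::nat).
       d \<ge> 1 \<longrightarrow> ordered_weights d \<eta> \<longrightarrow> \<sigma> > 0 \<longrightarrow> s \<in> {1..d} \<longrightarrow>
       minimax_risk d s \<eta> \<sigma> \<alpha> \<tau> \<ge> ennreal (c * \<sigma>\<^sup>2 * Phi_o \<alpha> d s \<eta>)) \<and>
    (\<forall>C::real. \<exists>c'>0. \<forall>(d::nat) (\<eta>::nat \<Rightarrow> real) (\<sigma>::real) (s::nat).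
       d \<ge> 1 \<longrightarrow> ordered_weights d \<eta> \<longrightarrow> \<sigma> > 0 \<longrightarrow> s \<in> {1..d} \<longrightarrow>
       s \<ge> 3 \<longrightarrow> s\<^sup>2 + s \<le> d + 1 \<longrightarrow>
       (\<Sum>j=s\<^sup>2..d. lambda_H \<alpha> d s \<eta> ^ 4 / \<eta> j ^ 4 *
          exp (- 2 * \<bar>lambda_H \<alpha> d s \<eta> / \<eta> j\<bar> powr \<alpha>)) \<le> C \<longrightarrow>
       minimax_risk d s \<eta> \<sigma> \<alpha> \<tau> \<ge> ennreal (c' * \<sigma>\<^sup>2 * (real s)\<^sup>2 * (lambda_H \<alpha> d s \<eta>)\<^sup>2))"
proof -
  obtain M where M: "M \<ge> 1" "\<And>x. x \<ge> 1 \<Longrightarrow> x ^ 4 * exp (- (x powr \<alpha> / 2)) \<le> M"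
    using power4_exp_bound[OF assms] by blast
  \<comment> \<open>\<open>t\<close> and \<open>c\<close> are built from \<alpha> and
    \<open>M\<close> before \<tau> and the model are fixed; \<open>c'\<close> depends in addition on
    \<open>C\<close> only.\<close>
  define t where "t = 4 * 2 powr (1 / \<alpha>)"
  define c where "c = (1 / (16 * M))\<^sup>2 / (72 * (1 + exp 8))"
  define c' where "c' C = (1 / (8 * M))\<^sup>2 / (32 * (1 + exp (8 * max C 1)))" for C
  have t: "t > 0" by (simp add: t_def)
  have c: "c > 0" and c': "c' C > 0" for C
    unfolding c_def c'_def using M(1) by (auto intro!: divide_pos_pos mult_pos_pos add_pos_pos)
  note first = minimax_risk_ge_Phi_o[OF assms _ _ _ _ _ M, folded t_def c_def]
  note second = minimax_risk_ge_lambda_H[OF assms _ _ _ _ _ _ M, folded t_def c'_def]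
  show ?thesis
  proof (rule exI[of _ t], rule conjI[OF t], rule exI[of _ c], rule conjI[OF c], intro allI impI conjI)
    fix \<tau> C assume "t \<le> \<tau>"
    thus "\<exists>c'>0. \<forall>(d::nat) (\<eta>::nat \<Rightarrow> real) (\<sigma>::real) (s::nat).
       d \<ge> 1 \<longrightarrow> ordered_weights d \<eta> \<longrightarrow> \<sigma> > 0 \<longrightarrow> s \<in> {1..d} \<longrightarrow>
       s \<ge> 3 \<longrightarrow> s\<^sup>2 + s \<le> d + 1 \<longrightarrow>
       (\<Sum>j=s\<^sup>2..d. lambda_H \<alpha> d s \<eta> ^ 4 / \<eta> j ^ 4 *
          exp (- 2 * \<bar>lambda_H \<alpha> d s \<eta> / \<eta> j\<bar> powr \<alpha>)) \<le> C \<longrightarrow>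
       minimax_risk d s \<eta> \<sigma> \<alpha> \<tau> \<ge> ennreal (c' * \<sigma>\<^sup>2 * (real s)\<^sup>2 * (lambda_H \<alpha> d s \<eta>)\<^sup>2)"
      by (intro exI[of _ "c' C"] conjI c' allI impI second) auto
  qed (auto intro!: first)
qed

end
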